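(* Let $p(t)$ be an irreducible Perron polynomial. Then there exist a free group $F_m$ with free basis $g_1,\dots,g_m$ and an endomorphism $\phi:F_m\to F_m$ such that for every $i=1,\dots,m$ the sequence of word lengths $\{|\phi^n(g_i)|\}_{n\ge1}$ is linearly recurrent with minimal polynomial equal to $p(t)$ times a product of cyclotomic polynomials. Consequently $\max_k\mathrm{GR}^{(k)}(\{|\phi^n(g_i)|\}_{n\ge1})=M(p)$.
   Context: A Perron polynomial is a monic polynomial with integer coefficients having a positive real root that is strictly larger than the modulus of each of its other roots. For $g$ in the free group $F_m$ with basis $g_1,\dots,g_m$, $|g|$ denotes the length of the shortest word in $g_1^{\pm1},\dots,g_m^{\pm1}$ representing $g$. A sequence is linearly recurrent if it satisfies a relation $a_{n+d}+c_{d-1}a_{n+d-1}+\cdots+c_0a_n=0$ for all $n$ with constant coefficients; its minimal polynomial is the monic polynomial $t^d+c_{d-1}t^{d-1}+\cdots+c_0$ of minimal degree arising this way. For a sequence $\mathbf{a}$ and $k\ge1$, $\mathrm{GR}^{(k)}(\mathbf{a})=\limsup_{n\to\infty}|\det H_{n,k}|^{1/n}$, where $H_{n,k}$ is the $k\times k$ matrix with $(i,j)$ entry $a_{n+i+j}$ ($0\le i,j\le k-1$); $\mathrm{GR}^{(0)}(\mathbf{a})=1$. The Mahler measure of a nonzero polynomial $f=c_dt^d+\cdots+c_0$ ($c_d\ne0$) with roots $r_j$ is $M(f)=|c_d|\prod_j\max(|r_j|,1)$. *)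

theory Defs
  imports "Berlekamp_Zassenhaus.Mahler_Measure" "Jordan_Normal_Form.Determinant"
    "HOL-Library.Extended_Real" "HOL-Library.Liminf_Limsup"
begin

definition perron_poly :: "int poly \<Rightarrow> bool" where
  "perron_poly p \<longleftrightarrow> lead_coeff p = 1 \<and>
     (\<exists>r::real. r > 0 \<and> poly (map_poly complex_of_int p) (complex_of_real r) = 0 \<and>
        (\<forall>z. poly (map_poly complex_of_int p) z = 0 \<and> z \<noteq> complex_of_real r \<longrightarrow> cmod z < r))"

text \<open>A letter (i, False) is the basis element g_i, (i, True) is its inverse.
  Elements of the free group F_m are the freely reduced words over letters with index < m.\<close>

type_synonym letter = "nat \<times> bool"

definition inv_letter :: "letter \<Rightarrow> letter" where
  "inv_letter x = (fst x, \<not> snd x)"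

definition inv_word :: "letter list \<Rightarrow> letter list" where
  "inv_word w = rev (map inv_letter w)"

fun cancel_step :: "letter \<Rightarrow> letter list \<Rightarrow> letter list" where
  "cancel_step x [] = [x]"
| "cancel_step x (y # ys) = (if y = inv_letter x then ys else x # y # ys)"

definition reduce :: "letter list \<Rightarrow> letter list" where
  "reduce w = foldr cancel_step w []"

definition word_on :: "nat \<Rightarrow> letter list \<Rightarrow> bool" where
  "word_on m w \<longleftrightarrow> (\<forall>x\<in>set w. fst x < m)"

text \<open>An endomorphism of F_m is determined by the images f i (i < m) of the basis elements;
  applying it to a word substitutes and freely reduces.\<close>
definition endo_apply :: "(nat \<Rightarrow> letter list) \<Rightarrow> letter list \<Rightarrow> letter list" where
  "endo_apply f w = reduce (concat (map (\<lambda>x. if snd x then inv_word (f (fst x)) else f (fst x)) w))"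

definition word_length :: "letter list \<Rightarrow> nat" where
  "word_length w = length (reduce w)"

definition annihilates :: "complex poly \<Rightarrow> (nat \<Rightarrow> real) \<Rightarrow> bool" where
  "annihilates q a \<longleftrightarrow> (\<forall>n. (\<Sum>j\<le>degree q. coeff q j * complex_of_real (a (n + j))) = 0)"

definition linearly_recurrent :: "(nat \<Rightarrow> real) \<Rightarrow> bool" where
  "linearly_recurrent a \<longleftrightarrow> (\<exists>q. lead_coeff q = 1 \<and> annihilates q a)"

definition minimal_poly_seq :: "(nat \<Rightarrow> real) \<Rightarrow> complex poly \<Rightarrow> bool" where
  "minimal_poly_seq a q \<longleftrightarrow> lead_coeff q = 1 \<and> annihilates q a \<and>
     (\<forall>r. lead_coeff r = 1 \<and> annihilates r a \<longrightarrow> degree q \<le> degree r)"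

definition cyclotomic :: "nat \<Rightarrow> complex poly" where
  "cyclotomic n = (\<Prod>k\<in>{k. k < n \<and> coprime k n}. [:- cis (2 * pi * real k / real n), 1:])"

definition hankel :: "(nat \<Rightarrow> real) \<Rightarrow> nat \<Rightarrow> nat \<Rightarrow> real mat" where
  "hankel a n k = mat k k (\<lambda>(i, j). a (n + i + j))"

definition GR :: "nat \<Rightarrow> (nat \<Rightarrow> real) \<Rightarrow> ereal" where
  "GR k a = (if k = 0 then 1
     else limsup (\<lambda>n. ereal (\<bar>det (hankel a n k)\<bar> powr (1 / real n))))"

end

theory Submission
  imports Defs
begin

text \<open>
  Let \<open>\<lambda>\<close> be the Perron root. A positive endomorphism has no cancellation, so it suffices to find a
  finite set \<open>S\<close> of integer sequences with \<open>a(0) = 1\<close> such that the shift of every \<open>a \<in> S\<close> is a sum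
  of members of \<open>S\<close>: the members are the generators, the summands spell the image, and \<open>a\<close> is the
  sequence of word lengths. For a large prime \<open>k\<close> we take sequences whose increments
  \<open>b(n) = a(n + k) - a(n)\<close> are killed by \<open>p\<close>, lie in a narrow cone around \<open>\<lambda>^n\<close>, and whose first
  \<open>k\<close> values increase and grow neither much faster nor much slower than \<open>b\<close> allows.
  With \<open>M = a(1)\<close>, the shift is divided into \<open>M\<close> parts by replacing each free value \<open>x\<close> by
  \<open>(x + j) div M\<close> for \<open>j < M\<close>; the increments are so large that rounding cannot push
  them out of the cone, and the cone condition bounds \<open>S\<close>.

  Such an \<open>a\<close> is killed by \<open>p (t^k - 1)\<close>, hence is a combination of \<open>z^n\<close> over distinct \<open>z\<close>.
  The coefficient at \<open>z\<close> vanishes iff a fixed integer polynomial does, so by irreducibility of \<open>p\<close>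
  and of \<open>1 + t + \<dots> + t^(k-1)\<close> the support is a union of full root sets; it contains the roots of
  \<open>p\<close> because \<open>a\<close> is not periodic. Expanding the \<open>d \<times> d\<close> Hankel determinant
  over \<open>d\<close>-element subsets of the support, for a suitable \<open>d\<close> the set of roots outside the unit
  circle strictly dominates.
\<close>

section \<open>Linear recurrences with constant coefficients\<close>

text \<open>The polynomial \<open>q\<close> evaluated at the shift operator and applied to
  \<open>s\<close>. Products of polynomials act by composition (\<open>rec_op_mult\<close>), so
  linear factors can be stripped off a recurrence one at a time.\<close>

definition rec_op :: "'a::comm_ring_1 poly \<Rightarrow> (nat \<Rightarrow> 'a) \<Rightarrow> nat \<Rightarrow> 'a" where
  "rec_op q s n = (\<Sum>j\<le>degree q. coeff q j * s (n + j))"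

lemma rec_op_eq_sum: "degree q \<le> N \<Longrightarrow> rec_op q s n = (\<Sum>j\<le>N. coeff q j * s (n + j))"
  unfolding rec_op_def by (rule sum.mono_neutral_left) (auto simp: coeff_eq_0 not_le)

lemma rec_op_0 [simp]: "rec_op 0 s n = 0"
  by (simp add: rec_op_def)

lemma rec_op_pCons: "rec_op (pCons c q) s n = c * s n + rec_op q s (Suc n)"
proof -
  have "rec_op (pCons c q) s n = (\<Sum>j\<le>Suc (degree q). coeff (pCons c q) j * s (n + j))"
    by (rule rec_op_eq_sum) (rule degree_pCons_le)
  also have "\<dots> = c * s n + (\<Sum>j\<le>degree q. coeff q j * s (Suc n + j))"
    by (subst sum.atMost_Suc_shift) simp
  finally show ?thesis by (simp add: rec_op_def)
qed

lemma rec_op_1 [simp]: "rec_op 1 s n = s n"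
  by (simp add: rec_op_def)

lemma rec_op_linear_factor: "rec_op [:- z, 1:] s n = s (Suc n) - z * s n"
  by (simp add: rec_op_pCons)

lemma rec_op_add: "rec_op (q + q') s n = rec_op q s n + rec_op q' s n"
proof -
  let ?N = "max (degree q) (degree q')"
  have "degree (q + q') \<le> ?N" by (rule degree_add_le_max)
  then show ?thesis
    by (simp add: rec_op_eq_sum[of _ ?N] sum.distrib algebra_simps)
qed

lemma rec_op_smult: "rec_op (smult c q) s n = c * rec_op q s n"
  by (subst rec_op_eq_sum[OF degree_smult_le]) (simp add: rec_op_def sum_distrib_left mult.assoc)

lemma rec_op_mult: "rec_op (q * q') s n = rec_op q (rec_op q' s) n"
  by (induction q arbitrary: n) (simp_all add: rec_op_pCons rec_op_add rec_op_smult)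

lemma rec_op_mult': "rec_op (q * q') s n = rec_op q' (rec_op q s) n"
  by (subst mult.commute) (rule rec_op_mult)

lemma rec_op_zero_seq [simp]: "rec_op q (\<lambda>_. 0) n = 0"
  by (simp add: rec_op_def)

lemma rec_op_seq_diff: "rec_op q (\<lambda>n. s n - t n) n = rec_op q s n - rec_op q t n"
  by (simp add: rec_op_def sum_subtractf algebra_simps)

lemma rec_op_seq_cmult: "rec_op q (\<lambda>n. c * s n) n = c * rec_op q s n"
  by (simp add: rec_op_def sum_distrib_left algebra_simps)

lemma rec_op_seq_sum: "rec_op q (\<lambda>n. \<Sum>i\<in>I. s i n) n = (\<Sum>i\<in>I. rec_op q (s i) n)"
  by (simp add: rec_op_def sum_distrib_left) (rule sum.swap)

lemma rec_op_shift: "rec_op q (\<lambda>n. s (n + m)) n = rec_op q s (n + m)"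
  by (simp add: rec_op_def add_ac)

lemma rec_op_geometric: "rec_op q (\<lambda>n. z ^ n) n = poly q z * z ^ n"
  by (induction q arbitrary: n) (simp_all add: rec_op_pCons algebra_simps)

lemma rec_op_exp_sum:
  "rec_op q (\<lambda>n. \<Sum>z\<in>Z. \<alpha> z * z ^ n) n = (\<Sum>z\<in>Z. \<alpha> z * poly q z * z ^ n)"
  by (simp add: rec_op_seq_sum rec_op_seq_cmult rec_op_geometric mult.assoc)

lemma rec_op_of_int:
  "rec_op (map_poly (of_int :: int \<Rightarrow> 'a::{comm_ring_1,ring_char_0}) q) (\<lambda>n. of_int (s n)) n
     = of_int (rec_op q s n)"
  by (simp add: rec_op_def of_int_hom.degree_map_poly_hom)

lemma rec_op_of_real:
  "rec_op (map_poly (of_real :: real \<Rightarrow> complex) q) (\<lambda>n. of_real (s n)) n = of_real (rec_op q s n)"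
  by (simp add: rec_op_def of_real_hom.degree_map_poly_hom)

lemma rec_op_monic:
  assumes "lead_coeff q = 1"
  shows "rec_op q s n = (\<Sum>j<degree q. coeff q j * s (n + j)) + s (n + degree q)"
  using assms by (simp add: rec_op_def lessThan_Suc_atMost[symmetric])

section \<open>Solutions of monic recurrences\<close>

fun rec_seq :: "'a::comm_ring_1 poly \<Rightarrow> (nat \<Rightarrow> 'a) \<Rightarrow> nat \<Rightarrow> 'a" where
  "rec_seq q init n = (if n < degree q then init n
     else - (\<Sum>j<degree q. coeff q j * rec_seq q init (n - degree q + j)))"

declare rec_seq.simps [simp del]

lemma rec_seq_init: "n < degree q \<Longrightarrow> rec_seq q init n = init n"
  by (simp add: rec_seq.simps)

lemma rec_op_rec_seq:
  assumes "lead_coeff q = 1"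
  shows "rec_op q (rec_seq q init) n = 0"
proof -
  have "rec_seq q init (n + degree q) = - (\<Sum>j<degree q. coeff q j * rec_seq q init (n + j))"
    by (subst rec_seq.simps) simp
  then show ?thesis by (simp add: rec_op_monic[OF assms])
qed

text \<open>Monicity expresses each later value through the preceding \<open>degree q\<close> ones.
  Applied to differences, this reduces an identity between two solutions to their initial
  values.\<close>

lemma rec_op_zero_unique:
  assumes monic: "lead_coeff q = 1" and rec: "\<And>n. rec_op q s n = 0"
    and init: "\<And>i. i < degree q \<Longrightarrow> s i = 0"
  shows "s n = 0"
proof (induction n rule: less_induct)
  case (less n)
  show ?case
  proof (cases "n < degree q")
    case False
    then obtain m where m: "n = m + degree q" by (metis add.commute le_iff_add not_less)
    have "(\<Sum>j<degree q. coeff q j * s (m + j)) = 0"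
      by (rule sum.neutral) (use less m in auto)
    with rec[of m] show ?thesis by (simp add: rec_op_monic[OF monic] m)
  qed (use init in auto)
qed

section \<open>Exponential sums over distinct bases\<close>

text \<open>Stripping off the factor with root \<open>x\<close> leaves a sequence covered by the
  induction hypothesis; a first-order recurrence is then solved back. As \<open>Z\<close> is a set,
  the roots are distinct and constant coefficients suffice.\<close>

lemma exp_sum_exists:
  fixes s :: "nat \<Rightarrow> 'a::field"
  assumes "finite Z" and "\<And>n. rec_op (\<Prod>z\<in>Z. [:- z, 1:]) s n = 0"
  shows "\<exists>\<alpha>. \<forall>n. s n = (\<Sum>z\<in>Z. \<alpha> z * z ^ n)"
  using assms
proof (induction Z arbitrary: s rule: finite_induct)
  case (insert x Z)
  have "rec_op (\<Prod>z\<in>Z. [:- z, 1:]) (rec_op [:- x, 1:] s) n = 0" for n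
    using insert.prems[of n] unfolding prod.insert[OF insert.hyps] rec_op_mult' .
  from insert.IH[OF this] obtain \<beta> where
    \<beta>: "\<And>n. rec_op [:- x, 1:] s n = (\<Sum>z\<in>Z. \<beta> z * z ^ n)" by blast
  \<comment> \<open>The stripped factor multiplies \<open>z ^ n\<close> by \<open>z - x\<close>,
    which is nonzero on \<open>Z\<close>, so this division gives a particular solution. The rest
    \<open>t\<close> is geometric with ratio \<open>x\<close>.\<close>
  define \<gamma> where "\<gamma> z = \<beta> z / (z - x)" for z
  define t where "t n = s n - (\<Sum>z\<in>Z. \<gamma> z * z ^ n)" for n
  have "t (Suc n) - x * t n = 0" for n
  proof -
    have "rec_op [:- x, 1:] t n = rec_op [:- x, 1:] s n - (\<Sum>z\<in>Z. \<gamma> z * poly [:- x, 1:] z * z ^ n)"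
      unfolding t_def by (simp only: rec_op_seq_diff rec_op_exp_sum)
    also have "(\<Sum>z\<in>Z. \<gamma> z * poly [:- x, 1:] z * z ^ n) = (\<Sum>z\<in>Z. \<beta> z * z ^ n)"
    proof (rule sum.cong[OF refl])
      fix z assume "z \<in> Z"
      then have "z - x \<noteq> 0" using insert.hyps by auto
      then show "\<gamma> z * poly [:- x, 1:] z * z ^ n = \<beta> z * z ^ n"
        by (simp add: \<gamma>_def)
    qed
    finally have "rec_op [:- x, 1:] t n = 0" by (simp only: \<beta>) simp
    then show ?thesis by (simp only: rec_op_linear_factor)
  qed
  then have t: "t n = t 0 * x ^ n" for n
    by (induction n) (simp_all add: algebra_simps)
  have "s n = (\<Sum>z\<in>insert x Z. (if z = x then t 0 else \<gamma> z) * z ^ n)" for n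
  proof -
    have "(\<Sum>z\<in>Z. (if z = x then t 0 else \<gamma> z) * z ^ n) = (\<Sum>z\<in>Z. \<gamma> z * z ^ n)"
      by (rule sum.cong) (use insert.hyps in auto)
    moreover have "s n = t 0 * x ^ n + (\<Sum>z\<in>Z. \<gamma> z * z ^ n)"
      using t[of n] unfolding t_def[of n] by (simp add: diff_eq_eq)
    ultimately show ?thesis using insert.hyps by simp
  qed
  then show ?case
    by (intro exI[of _ "\<lambda>z. if z = x then t 0 else \<gamma> z"] allI)
qed simp

text \<open>The product vanishes at every base except \<open>z\<close>, so a single term survives.
  This reads off a coefficient up to a nonzero factor.\<close>

lemma rec_op_isolate:
  fixes \<alpha> :: "'a::field \<Rightarrow> 'a"
  assumes "finite Z" "z \<in> Z"
  shows "rec_op (\<Prod>w\<in>Z - {z}. [:- w, 1:]) (\<lambda>n. \<Sum>w\<in>Z. \<alpha> w * w ^ n) n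
           = \<alpha> z * (\<Prod>w\<in>Z - {z}. z - w) * z ^ n"
proof -
  have "poly (\<Prod>w\<in>Z - {z}. [:- w, 1:]) v = 0" if "v \<in> Z - {z}" for v
    using that assms by (auto simp: poly_prod)
  then have "(\<Sum>w\<in>Z - {z}. \<alpha> w * poly (\<Prod>w\<in>Z - {z}. [:- w, 1:]) w * w ^ n) = 0"
    by (intro sum.neutral) auto
  then show ?thesis
    unfolding rec_op_exp_sum using assms
    by (subst sum.remove[of Z z]) (simp_all add: poly_prod)
qed

lemma exp_sum_unique:
  fixes \<alpha> :: "'a::field \<Rightarrow> 'a"
  assumes "finite Z" "z \<in> Z" "\<And>n. (\<Sum>w\<in>Z. \<alpha> w * w ^ n) = 0"
  shows "\<alpha> z = 0"
proof -
  have "\<alpha> z * (\<Prod>w\<in>Z - {z}. z - w) = 0"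
    using rec_op_isolate[OF assms(1,2), of \<alpha> 0] by (simp add: assms(3))
  then show ?thesis using assms(1) by auto
qed

text \<open>At a root \<open>z\<close> of \<open>P\<close>, \<open>synthetic_div\<close> is the
  cofactor of the linear factor at \<open>z\<close>, so for simple roots the left side is the
  coefficient at \<open>z\<close> up to a nonzero factor. One \<open>G\<close> serves all
  \<open>z\<close>, which lets vanishing pass between conjugates. It exists because the synthetic
  quotient has coefficients that are integer polynomials in \<open>z\<close>.\<close>

lemma exp_sum_coeff_int_poly:
  fixes P :: "int poly" and s :: "nat \<Rightarrow> int"
  shows "\<exists>G. \<forall>z::complex. rec_op (synthetic_div (map_poly of_int P) z) (\<lambda>n. of_int (s n)) 0
           = poly (map_poly of_int G) z"
proof (induction P arbitrary: s)
  case (pCons a P)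
  obtain G where G: "\<And>z::complex. rec_op (synthetic_div (map_poly of_int P) z)
      (\<lambda>n. of_int (s (Suc n))) 0 = poly (map_poly of_int G) z"
    using pCons.IH[of "\<lambda>n. s (Suc n)"] by blast
  have "rec_op (synthetic_div (map_poly of_int (pCons a P)) z) (\<lambda>n. of_int (s n)) 0
      = poly (map_poly of_int (smult (s 0) P + G)) z" for z :: complex
  proof -
    have "rec_op q (\<lambda>n. of_int (s n)) (Suc 0) = rec_op q (\<lambda>n. of_int (s (Suc n))) 0"
      for q :: "complex poly"
      using rec_op_shift[of q "\<lambda>n. of_int (s n)" 1 0] by simp
    then show ?thesis
      using G[of z]
      by (simp add: of_int_hom.map_poly_pCons_hom rec_op_pCons of_int_poly_hom.hom_add
          of_int_hom.map_poly_hom_smult synthetic_div_pCons)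
  qed
  then show ?case by blast
qed (auto intro: exI[of _ 0])

text \<open>Repetitions in \<open>zs\<close> are allowed: the strict inequality
  \<open>cmod z < r\<close> absorbs the polynomial factors that multiple roots may produce.\<close>

lemma rec_op_growth:
  fixes s :: "nat \<Rightarrow> complex"
  assumes "\<And>n. rec_op (\<Prod>z\<leftarrow>zs. [:- z, 1:]) s n = 0" "\<And>z. z \<in> set zs \<Longrightarrow> cmod z < r" "0 < r"
  shows "\<exists>C. \<forall>n. cmod (s n) \<le> C * r ^ n"
  using assms
proof (induction zs arbitrary: s)
  case Nil
  then show ?case by (intro exI[of _ 0]) simp
next
  case (Cons z zs)
  have "rec_op (\<Prod>z\<leftarrow>zs. [:- z, 1:]) (rec_op [:- z, 1:] s) n = 0" for n
    using Cons.prems(1)[of n] unfolding list.map prod_list.Cons rec_op_mult' .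
  from Cons.IH[OF this] Cons.prems obtain C where
    "\<forall>n. cmod (rec_op [:- z, 1:] s n) \<le> C * r ^ n" by (meson list.set_intros(2))
  then have C: "\<And>n. cmod (s (Suc n) - z * s n) \<le> C * r ^ n"
    by (simp only: rec_op_linear_factor)
  have zr: "cmod z < r" using Cons.prems by simp
  \<comment> \<open>The second entry gives \<open>C + cmod z * D \<le> r * D\<close>, which closes
    the induction; the first one starts it.\<close>
  define D where "D = max (cmod (s 0)) (C / (r - cmod z))"
  have "C / (r - cmod z) \<le> D" by (simp add: D_def)
  then have CD: "C \<le> D * (r - cmod z)"
    using zr by (simp add: pos_divide_le_eq)
  have "cmod (s n) \<le> D * r ^ n" for n
  proof (induction n)
    case (Suc n)
    have "cmod (s (Suc n)) \<le> cmod (s (Suc n) - z * s n) + cmod z * cmod (s n)"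
      by (metis diff_add_cancel norm_mult norm_triangle_ineq)
    also have "\<dots> \<le> C * r ^ n + cmod z * (D * r ^ n)"
      by (intro add_mono C mult_left_mono Suc) simp
    also have "\<dots> \<le> D * (r - cmod z) * r ^ n + cmod z * (D * r ^ n)"
      using CD \<open>0 < r\<close> by (intro add_right_mono mult_right_mono) auto
    finally show ?case by (simp add: algebra_simps)
  qed (simp add: D_def)
  then show ?case by blast
qed

section \<open>Irreducibility and roots\<close>

text \<open>A minimal-degree integer polynomial vanishing at \<open>z\<close> divides, up to a constant, every other one.\<close>

lemma irreducible_dvd_if_common_root:
  fixes p G :: "int poly" and z :: complex
  assumes irr: "irreducible p"
    and z: "poly (map_poly of_int p) z = 0" "poly (map_poly of_int G) z = 0"
  shows "p dvd G"
proof (cases "G = 0")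
  case False
  define V where "V = {g :: int poly. g \<noteq> 0 \<and> poly (map_poly of_int g) z = 0}"
  have "G \<in> V" using False z by (simp add: V_def)
  then obtain g where g: "g \<in> V" and min: "\<And>h. h \<in> V \<Longrightarrow> degree g \<le> degree h"
    using ex_has_least_nat[of "\<lambda>g. g \<in> V" G degree] by blast
  have g0: "g \<noteq> 0" and gz: "poly (map_poly of_int g) z = 0" using g by (auto simp: V_def)
  have dvd: "\<exists>c q. c \<noteq> 0 \<and> smult c h = g * q"
    if "poly (map_poly of_int h) z = 0" for h :: "int poly"
  proof -
    \<comment> \<open>Pseudo-division, because the leading coefficient of \<open>g\<close> need not
      be a unit. The remainder again vanishes at \<open>z\<close>, so minimality of
      \<open>degree g\<close> makes it zero.\<close>
    obtain q r where qr: "pseudo_divmod h g = (q, r)" by fastforce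
    define c where "c = lead_coeff g ^ (Suc (degree h) - degree g)"
    have eq: "smult c h = g * q + r" and "r = 0 \<or> degree r < degree g"
      using pseudo_divmod[OF g0 qr] by (auto simp: c_def)
    moreover have "poly (map_poly of_int r) z = 0"
    proof -
      have "poly (map_poly of_int (smult c h)) z = poly (map_poly of_int (g * q + r)) z"
        by (simp add: eq)
      then show ?thesis
        using that gz by (simp add: of_int_poly_hom.hom_add of_int_poly_hom.hom_mult
            of_int_hom.map_poly_hom_smult)
    qed
    ultimately have "r = 0" using min[of r] by (force simp: V_def)
    then show ?thesis using eq g0 by (intro exI[of _ c] exI[of _ q]) (auto simp: c_def)
  qed
  have prime: "prime_elem p" using irr by (simp add: prime_elem_iff_irreducible)
  have deg_p: "degree p \<noteq> 0"
  proof
    assume "degree p = 0"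
    then obtain a where "p = [:a:]" by (metis degree_0_id)
    then show False using irr z(1) by (auto simp: of_int_hom.map_poly_pCons_hom irreducible_def)
  qed
  have pc: "\<not> p dvd [:c:]" if "c \<noteq> 0" for c
    using deg_p that dvd_imp_degree_le[of p "[:c:]"] by auto
  obtain c q where c: "c \<noteq> 0" "smult c p = g * q" using dvd[OF z(1)] by blast
  have "p dvd g * q" using c(2) by (metis dvd_smult dvd_refl)
  \<comment> \<open>If \<open>q\<close> absorbed \<open>p\<close>, comparing degrees would make
    \<open>g\<close> a nonzero constant, which has no root.\<close>
  moreover have "\<not> p dvd q"
  proof
    assume "p dvd q"
    moreover have "q \<noteq> 0" using c irr by auto
    ultimately have "degree p \<le> degree q" by (simp add: dvd_imp_degree_le)
    moreover have "degree p = degree g + degree q"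
      using c g0 \<open>q \<noteq> 0\<close> by (metis degree_mult_eq degree_smult_eq)
    ultimately have "degree g = 0" by simp
    then obtain a where "g = [:a:]" by (metis degree_0_id)
    then show False using g0 gz by auto
  qed
  ultimately have "p dvd g" using prime by (simp add: prime_elem_dvd_mult_iff)
  moreover obtain c' q' where c': "c' \<noteq> 0" "smult c' G = g * q'" using dvd[OF z(2)] by blast
  ultimately have "p dvd [:c':] * G" by simp
  then show ?thesis using prime pc[OF c'(1)] by (metis prime_elem_dvd_mult_iff)
qed simp

text \<open>Integer polynomials cannot tell the roots of \<open>p\<close> apart: vanishing at one
  root already means being a multiple of \<open>p\<close>.\<close>

lemma irreducible_root_transfer:
  fixes p G :: "int poly" and z w :: complex
  assumes "irreducible p" "poly (map_poly of_int p) z = 0" "poly (map_poly of_int G) z = 0"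
    and w: "poly (map_poly of_int p) w = 0"
  shows "poly (map_poly of_int G) w = 0"
proof -
  obtain h where "G = p * h" using irreducible_dvd_if_common_root[OF assms(1-3)] by blast
  then show ?thesis using w by (simp add: of_int_poly_hom.hom_mult)
qed

text \<open>A multiple root is shared with the derivative, so \<open>p\<close> would divide a
  nonzero polynomial of smaller degree.\<close>

lemma irreducible_root_simple:
  fixes p :: "int poly" and z :: complex
  assumes irr: "irreducible p" and z: "poly (map_poly of_int p) z = 0"
  shows "poly (pderiv (map_poly of_int p)) z \<noteq> 0"
proof
  assume "poly (pderiv (map_poly of_int p)) z = 0"
  then have "poly (map_poly of_int (pderiv p)) z = 0" by (simp add: of_int_hom.map_poly_pderiv)
  then have dvd: "p dvd pderiv p" by (rule irreducible_dvd_if_common_root[OF irr z])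
  show False
  proof (cases "degree p = 0")
    case True
    then have p: "p = [:coeff p 0:]" by (simp add: degree_0_id)
    have "poly (map_poly complex_of_int [:coeff p 0:]) z = 0" using z p by simp
    then have "coeff p 0 = 0" by (simp add: of_int_hom.map_poly_pCons_hom)
    then have "p = 0" using True by (metis leading_coeff_0_iff)
    then show False using irr by (simp add: irreducible_def)
  next
    case False
    then have "pderiv p \<noteq> 0" by (simp add: pderiv_eq_0_iff)
    then show False using dvd_imp_degree_le[OF dvd] False by (simp add: degree_pderiv)
  qed
qed

text \<open>Simple roots make the list of linear factors free of repetitions, so the product can run
  over the root set, the form that \<open>exp_sum_exists\<close> needs.\<close>

lemma split_into_roots:
  fixes P :: "complex poly"
  assumes "lead_coeff P = 1" "\<And>z. poly P z = 0 \<Longrightarrow> poly (pderiv P) z \<noteq> 0"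
  shows "P = (\<Prod>z\<in>{z. poly P z = 0}. [:- z, 1:])"
proof -
  obtain as where as: "smult (lead_coeff P) (\<Prod>a\<leftarrow>as. [:- a, 1:]) = P" "length as = degree P"
    using fundamental_theorem_algebra_factorized[of P] by blast
  have P0: "P \<noteq> 0" using assms(1) by auto
  have P: "P = (\<Prod>a\<leftarrow>as. [:- a, 1:])" using as(1) assms(1) by simp
  have roots: "{z. poly P z = 0} = set as"
    by (subst P) (auto simp: poly_prod_list prod_list_zero_iff)
  have "rsquarefree P" using assms(2) by (auto simp: rsquarefree_roots)
  then have "card (set as) = length as"
    using rsquarefree_card_degree[OF P0] as(2) by (simp add: roots)
  then have "distinct as" by (rule card_distinct)
  then show ?thesis unfolding roots by (subst P) (simp add: prod.distinct_set_conv_list)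
qed

section \<open>Irreducibility of the cyclotomic polynomial of prime order\<close>

text \<open>For prime \<open>k\<close> this is the integer counterpart of the complex product
  \<open>cyclotomic k\<close>; irreducibility over the integers can be stated for it.\<close>

definition prime_cyclo :: "nat \<Rightarrow> int poly" where
  "prime_cyclo k = (\<Sum>i<k. monom 1 i)"

lemma prime_cyclo_mult: "[:-1, 1:] * prime_cyclo k = monom 1 k - 1"
proof (induction k)
  case (Suc k)
  have "prime_cyclo (Suc k) = prime_cyclo k + monom 1 k" by (simp add: prime_cyclo_def)
  then have "[:-1, 1:] * prime_cyclo (Suc k) = monom 1 k - 1 + [:-1, 1:] * monom 1 k"
    using Suc by (simp only: distrib_left)
  also have "[:-1, 1:] * monom 1 k = monom 1 (Suc k) - (monom 1 k :: int poly)"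
    by (simp add: monom_Suc)
  finally show ?case by simp
qed (simp add: prime_cyclo_def)

lemma prime_cyclo_1: "poly (prime_cyclo k) 1 = int k"
  by (simp add: prime_cyclo_def poly_sum poly_monom)

lemma prime_cyclo_root_iff:
  fixes z :: complex
  shows "k > 0 \<Longrightarrow> poly (map_poly of_int (prime_cyclo k)) z = 0 \<longleftrightarrow> z ^ k = 1 \<and> z \<noteq> 1"
proof -
  assume k: "k > 0"
  have "(z - 1) * poly (map_poly of_int (prime_cyclo k)) z = z ^ k - 1"
    using arg_cong[OF prime_cyclo_mult[of k], of "\<lambda>q. poly (map_poly complex_of_int q) z"]
    by (simp add: of_int_poly_hom.hom_mult of_int_poly_hom.hom_minus poly_monom
        of_int_hom.map_poly_pCons_hom algebra_simps)
  moreover have "poly (map_poly of_int (prime_cyclo k)) (1::complex) \<noteq> 0"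
    using k by (simp add: prime_cyclo_1 of_int_hom.poly_map_poly_1)
  ultimately show ?thesis by (cases "z = 1") auto
qed

lemma prime_cyclo_degree: "k > 0 \<Longrightarrow> degree (prime_cyclo k) = k - 1"
proof -
  assume "k > 0"
  then have "prime_cyclo k \<noteq> 0" using prime_cyclo_1[of k] by auto
  then have "degree ([:-1, 1:] * prime_cyclo k) = 1 + degree (prime_cyclo k)"
    by (subst degree_mult_eq) auto
  moreover have "degree (monom 1 k - 1 :: int poly) = k"
    using \<open>k > 0\<close> degree_add_eq_left[of "- 1 :: int poly" "monom 1 k"] by (simp add: degree_monom_eq)
  ultimately show ?thesis using prime_cyclo_mult[of k] by simp
qed

lemma prime_cyclo_monic: "k > 0 \<Longrightarrow> lead_coeff (prime_cyclo k) = 1"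
  by (simp add: prime_cyclo_degree) (simp add: prime_cyclo_def coeff_sum)

text \<open>For prime \<open>k\<close> every nontrivial root generates the group of
  \<open>k\<close>-th roots of unity: by Bezout its first \<open>k\<close> powers are distinct, and
  counting shows that they exhaust the group.\<close>

lemma roots_unity_prime:
  assumes k: "prime (k::nat)" and z: "(z::complex) ^ k = 1" "z \<noteq> 1" and w: "w ^ k = 1" "w \<noteq> 1"
  shows "\<exists>j\<in>{1..<k}. w ^ j = z"
proof -
  have k0: "k > 0" using k by (simp add: prime_gt_0_nat)
  have inj: "inj_on (\<lambda>j. w ^ j) {..<k}"
  proof -
    have aux: False if "i < j" "j < k" "w ^ i = w ^ j" for i j
    proof -
      have "w \<noteq> 0" using w k0 by (metis zero_neq_one power_0_left not_gr0)
      then have "w ^ (j - i) = 1" using that by (simp add: power_diff)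
      moreover have d: "0 < j - i" "j - i < k" using that by auto
      then have "\<not> k dvd j - i" using nat_dvd_not_less by blast
      then have "algebraic_semidom_class.coprime k (j - i)" by (rule prime_imp_coprime[OF k])
      then have "gcd (j - i) k = 1" by (simp add: gcd.commute)
      then obtain x y where "(j - i) * x = k * y + 1"
        using bezout_nat[of "j - i" k] d by auto
      then have "(w ^ (j - i)) ^ x = (w ^ k) ^ y * w" by (simp flip: power_mult power_add add: power_Suc2)
      then have "w = (w ^ (j - i)) ^ x" using w(1) by simp
      ultimately show False using w(2) by simp
    qed
    show ?thesis by (rule inj_onI) (metis aux lessThan_iff linorder_neqE_nat)
  qed
  have "(\<lambda>j. w ^ j) ` {..<k} = {z. z ^ k = 1}"
  proof (rule card_subset_eq)
    show "finite {z::complex. z ^ k = 1}" using k0 by (simp add: finite_roots_unity)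
    show "(\<lambda>j. w ^ j) ` {..<k} \<subseteq> {z. z ^ k = 1}"
      using w(1) by (auto simp flip: power_mult simp: mult.commute[of _ k]) (simp add: power_mult)
    show "card ((\<lambda>j. w ^ j) ` {..<k}) = card {z::complex. z ^ k = 1}"
      using inj k0 by (simp add: card_image card_roots_unity_eq)
  qed
  moreover have "z \<in> {z. z ^ k = 1}" using z(1) by simp
  ultimately have "z \<in> (\<lambda>j. w ^ j) ` {..<k}" by (simp only:)
  then obtain j where j: "j < k" "z = w ^ j" by auto
  moreover have "j \<noteq> 0" using z(2) j(2) by (cases j) auto
  ultimately show ?thesis by auto
qed

text \<open>If \<open>\<Phi> = g h\<close> with \<open>g(1) = \<plusminus>1\<close> and \<open>g\<close> non-constant, then \<open>\<Phi>\<close> divides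
  \<open>\<Prod>j. g(t ^ j)\<close>, whose value at \<open>1\<close> is a unit, although \<open>\<Phi>(1) = k\<close>.\<close>

lemma prime_cyclo_irreducible:
  assumes k: "prime k"
  shows "irreducible (prime_cyclo k)"
proof (rule irreducibleI)
  let ?Phi = "prime_cyclo k"
  have k0: "k > 0" and k1: "k > 1" using prime_gt_0_nat[OF k] prime_gt_1_nat[OF k] .
  show "?Phi \<noteq> 0" using prime_cyclo_1[of k] k0 by auto
  show "\<not> ?Phi dvd 1"
    using prime_cyclo_degree[OF k0] k1 dvd_imp_degree_le[of ?Phi 1] by auto
  have key: False if gh: "?Phi = g * h" and g1: "\<bar>poly g 1\<bar> = 1" and deg: "degree g > 0" for g h
  proof -
    have "degree (map_poly complex_of_int g) > 0" using deg by simp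
    then obtain w where w: "poly (map_poly complex_of_int g) w = 0"
      using fundamental_theorem_of_algebra_alt[of "map_poly complex_of_int g"]
      by (metis degree_pCons_0 less_irrefl)
    then have "poly (map_poly of_int ?Phi) w = 0" by (simp add: gh of_int_poly_hom.hom_mult)
    then have wk: "w ^ k = 1" "w \<noteq> 1" using prime_cyclo_root_iff[OF k0] by auto
    define F where "F = (\<Prod>j\<in>{1..<k}. pcompose g (monom 1 j))"
    \<comment> \<open>Some power \<open>z ^ j\<close> with \<open>0 < j < k\<close> is the chosen
      root \<open>w\<close> of \<open>g\<close>, so the factor of \<open>F\<close> with index
      \<open>j\<close> vanishes at \<open>z\<close>.\<close>
    have F0: "poly (map_poly of_int F) z = 0" if z: "z ^ k = 1" "z \<noteq> 1" for z :: complex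
    proof -
      obtain j where j: "j \<in> {1..<k}" "z ^ j = w" using roots_unity_prime[OF k wk z] by blast
      have "poly (map_poly of_int (pcompose g (monom 1 j))) z = 0"
        using w j by (simp add: of_int_hom.map_poly_pcompose poly_pcompose poly_monom)
      then show ?thesis using j(1)
        unfolding F_def of_int_poly_hom.hom_prod poly_prod by (intro prod_zero) auto
    qed
    obtain q r where qr: "pseudo_divmod F ?Phi = (q, r)" by fastforce
    have eq: "F = ?Phi * q + r" and r: "r = 0 \<or> degree r < k - 1"
      using pseudo_divmod[OF \<open>?Phi \<noteq> 0\<close> qr] prime_cyclo_degree[OF k0] prime_cyclo_monic[OF k0]
      by auto
    \<comment> \<open>The remainder inherits all \<open>k - 1\<close> nontrivial roots of unity from
      \<open>F\<close> and \<open>?Phi\<close>, too many for its degree.\<close>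
    have "r = 0"
    proof (rule ccontr)
      assume "r \<noteq> 0"
      let ?r = "map_poly complex_of_int r"
      have "{z. z ^ k = 1} - {1} \<subseteq> {z. poly ?r z = 0}"
      proof
        fix z :: complex assume "z \<in> {z. z ^ k = 1} - {1}"
        then have "poly (map_poly of_int F) z = 0" "poly (map_poly of_int ?Phi) z = 0"
          using F0 prime_cyclo_root_iff[OF k0] by auto
        then show "z \<in> {z. poly ?r z = 0}"
          by (simp add: eq of_int_poly_hom.hom_mult of_int_poly_hom.hom_add)
      qed
      moreover have "finite {z. poly ?r z = 0}" using \<open>r \<noteq> 0\<close> by (intro poly_roots_finite) simp
      ultimately have "card ({z::complex. z ^ k = 1} - {1}) \<le> card {z. poly ?r z = 0}"
        by (rule card_mono[rotated])
      also have "\<dots> \<le> degree r" using card_poly_roots_bound[of ?r] \<open>r \<noteq> 0\<close> by simp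
      finally show False using r \<open>r \<noteq> 0\<close> k0 by (simp add: card_roots_unity_eq)
    qed
    then have "poly F 1 = int k * poly q 1" by (simp add: eq prime_cyclo_1)
    moreover have "\<bar>poly F 1\<bar> = 1"
      by (simp add: F_def poly_prod poly_pcompose poly_monom abs_prod g1 power_abs)
    moreover have "int k dvd int k * poly q 1" by simp
    ultimately have "int k dvd 1" by (metis dvd_abs_iff)
    then show False using k1 by simp
  qed
  fix g h assume gh: "?Phi = g * h"
  have lead: "lead_coeff g * lead_coeff h = 1"
    using prime_cyclo_monic[OF k0] by (simp add: gh lead_coeff_mult)
  have unit: "f dvd 1" if "degree f = 0" "\<bar>lead_coeff f\<bar> = 1" for f :: "int poly"
  proof -
    have "[:coeff f 0:] dvd 1" using that by (simp add: is_unit_const_poly_iff)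
    then show ?thesis by (simp only: degree_0_id[OF that(1)])
  qed
  have l: "\<bar>lead_coeff g\<bar> = 1" "\<bar>lead_coeff h\<bar> = 1"
    using lead abs_zmult_eq_1[of "lead_coeff g" "lead_coeff h"]
      abs_zmult_eq_1[of "lead_coeff h" "lead_coeff g"] by (simp_all add: mult.commute)
  \<comment> \<open>The values at 1 multiply to a prime, so one of them is a unit and
    \<open>key\<close> makes the corresponding factor constant.\<close>
  have "poly g 1 * poly h 1 = int k" using prime_cyclo_1[of k] by (simp add: gh)
  then have "\<bar>poly g 1\<bar> * \<bar>poly h 1\<bar> = int k" by (simp flip: abs_mult)
  then have "int (nat \<bar>poly g 1\<bar> * nat \<bar>poly h 1\<bar>) = int k" by simp
  then have "nat \<bar>poly g 1\<bar> * nat \<bar>poly h 1\<bar> = k" by (simp only: of_nat_eq_iff)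
  then have "nat \<bar>poly g 1\<bar> = 1 \<or> nat \<bar>poly h 1\<bar> = 1"
    using k prime_product by blast
  then have "\<bar>poly g 1\<bar> = 1 \<or> \<bar>poly h 1\<bar> = 1" by linarith
  moreover have "degree g = 0" if "\<bar>poly g 1\<bar> = 1" using key[OF gh that] by auto
  moreover have "degree h = 0" if "\<bar>poly h 1\<bar> = 1"
    using key[of h g] gh that by (auto simp: mult.commute)
  ultimately show "g dvd 1 \<or> h dvd 1" using unit l by blast
qed

section \<open>Hankel determinants of exponential sums\<close>

definition vander :: "nat \<Rightarrow> (nat \<Rightarrow> complex) \<Rightarrow> complex mat" where
  "vander k g = mat k k (\<lambda>(i, j). g i ^ j)"

text \<open>The weight of the choice \<open>g\<close> of one base per row in the expanded Hankel
  determinant, with the dependence on \<open>n\<close> split off.\<close>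

definition hankel_coeff :: "nat \<Rightarrow> (complex \<Rightarrow> complex) \<Rightarrow> (nat \<Rightarrow> complex) \<Rightarrow> complex" where
  "hankel_coeff k \<alpha> g = (\<Prod>i<k. \<alpha> (g i) * g i ^ i) * det (vander k g)"

definition exp_hankel :: "nat \<Rightarrow> (complex \<Rightarrow> complex) \<Rightarrow> complex set \<Rightarrow> nat \<Rightarrow> complex mat" where
  "exp_hankel k \<alpha> Z n = mat k k (\<lambda>(i, j). \<Sum>z\<in>Z. \<alpha> z * z ^ (n + i + j))"

lemma permutes_less:
  fixes \<pi> :: "nat \<Rightarrow> nat"
  assumes "\<pi> permutes {0..<k}" "i < k" shows "\<pi> i < k"
  using permutes_in_image[OF assms(1), of i] assms(2) by simp

text \<open>Expanding every row into its exponential terms turns the Leibniz sum into Vandermonde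
  determinants. Choices are all functions \<open>g\<close> rather than subsets; those with the same
  image share the same base of the \<open>n\<close>-th power.\<close>

lemma det_exp_hankel:
  assumes "finite Z"
  shows "det (exp_hankel k \<alpha> Z n)
    = (\<Sum>g\<in>{..<k} \<rightarrow>\<^sub>E Z. hankel_coeff k \<alpha> g * (\<Prod>i<k. g i) ^ n)"
proof -
  let ?P = "{\<pi>. \<pi> permutes {0..<k}}"
  have "det (exp_hankel k \<alpha> Z n)
      = (\<Sum>\<pi>\<in>?P. of_int (sign \<pi>) * (\<Prod>i<k. exp_hankel k \<alpha> Z n $$ (i, \<pi> i)))"
    by (subst det_def'[of _ k]) (simp_all add: exp_hankel_def atLeast0LessThan)
  also have "\<dots> = (\<Sum>\<pi>\<in>?P. of_int (sign \<pi>) * (\<Prod>i<k. \<Sum>z\<in>Z. \<alpha> z * z ^ (n + i + \<pi> i)))"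
    by (intro sum.cong refl arg_cong2[of _ _ _ _ "(*)"] prod.cong)
      (auto simp: exp_hankel_def permutes_less)
  also have "\<dots> = (\<Sum>\<pi>\<in>?P. of_int (sign \<pi>) *
      (\<Sum>g\<in>{..<k} \<rightarrow>\<^sub>E Z. \<Prod>i<k. \<alpha> (g i) * g i ^ (n + i + \<pi> i)))"
    using assms by (subst prod_sum_PiE) auto
  also have "\<dots> = (\<Sum>g\<in>{..<k} \<rightarrow>\<^sub>E Z. \<Sum>\<pi>\<in>?P. of_int (sign \<pi>) *
      (\<Prod>i<k. \<alpha> (g i) * g i ^ (n + i + \<pi> i)))"
    by (simp add: sum_distrib_left) (rule sum.swap)
  also have "\<dots> = (\<Sum>g\<in>{..<k} \<rightarrow>\<^sub>E Z. hankel_coeff k \<alpha> g * (\<Prod>i<k. g i) ^ n)"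
  proof (rule sum.cong[OF refl])
    fix g assume "g \<in> {..<k} \<rightarrow>\<^sub>E Z"
    have "det (vander k g) = (\<Sum>\<pi>\<in>?P. of_int (sign \<pi>) * (\<Prod>i<k. g i ^ \<pi> i))"
      by (subst det_def'[of _ k])
        (auto simp: vander_def atLeast0LessThan permutes_less intro!: sum.cong prod.cong)
    moreover have "(\<Prod>i<k. \<alpha> (g i) * g i ^ (n + i + \<pi> i))
        = (\<Prod>i<k. \<alpha> (g i) * g i ^ i) * (\<Prod>i<k. g i) ^ n * (\<Prod>i<k. g i ^ \<pi> i)" for \<pi>
      unfolding prod_power_distrib prod.distrib[symmetric]
      by (intro prod.cong refl) (simp add: power_add algebra_simps)
    ultimately show "(\<Sum>\<pi>\<in>?P. of_int (sign \<pi>) * (\<Prod>i<k. \<alpha> (g i) * g i ^ (n + i + \<pi> i)))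
        = hankel_coeff k \<alpha> g * (\<Prod>i<k. g i) ^ n"
      by (simp add: hankel_coeff_def sum_distrib_left mult_ac)
  qed
  finally show ?thesis .
qed

lemma hankel_coeff_not_inj:
  assumes "\<not> inj_on g {..<k}" shows "hankel_coeff k \<alpha> g = 0"
proof -
  obtain i j where ij: "i < k" "j < k" "i \<noteq> j" "g i = g j"
    using assms by (auto simp: inj_on_def)
  have "det (vander k g) = 0"
    by (rule det_identical_rows[of _ k i j]) (use ij in \<open>auto simp: vander_def intro!: eq_vecI\<close>)
  then show ?thesis by (simp add: hankel_coeff_def)
qed

text \<open>A kernel vector \<open>v\<close> yields a polynomial \<open>R\<close> of degree below
  \<open>k\<close> for which the sums of \<open>\<alpha> z * R z * z ^ i\<close> vanish for
  \<open>i < k\<close>. Isolating one base uses a polynomial of degree \<open>k - 1\<close>, hence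
  only these sums; so \<open>R\<close> vanishes at all \<open>k\<close> points of \<open>B\<close>
  and \<open>v\<close> is zero.\<close>

lemma det_exp_hankel_full:
  assumes fin: "finite B" and card: "card B = k" and \<alpha>: "\<And>z. z \<in> B \<Longrightarrow> \<alpha> z \<noteq> 0"
  shows "det (exp_hankel k \<alpha> B 0) \<noteq> 0"
proof
  let ?H = "exp_hankel k \<alpha> B 0"
  have H: "?H \<in> carrier_mat k k" by (simp add: exp_hankel_def)
  assume "det ?H = 0"
  then obtain v where v: "v \<in> carrier_vec k" "v \<noteq> 0\<^sub>v k" "?H *\<^sub>v v = 0\<^sub>v k"
    using det_0_iff_vec_prod_zero[OF H] by blast
  define R where "R z = (\<Sum>j<k. v $ j * z ^ j)" for z
  have R: "(\<Sum>z\<in>B. \<alpha> z * R z * z ^ i) = 0" if "i < k" for i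
  proof -
    have "(?H *\<^sub>v v) $ i = 0" using that v(3) by simp
    then have "(\<Sum>j<k. (\<Sum>z\<in>B. \<alpha> z * z ^ (i + j)) * v $ j) = 0"
      using that v(1) by (simp add: exp_hankel_def scalar_prod_def atLeast0LessThan)
    also have "(\<Sum>j<k. (\<Sum>z\<in>B. \<alpha> z * z ^ (i + j)) * v $ j)
        = (\<Sum>j<k. \<Sum>z\<in>B. \<alpha> z * z ^ (i + j) * v $ j)"
      by (simp add: sum_distrib_right)
    also have "\<dots> = (\<Sum>z\<in>B. \<Sum>j<k. \<alpha> z * z ^ (i + j) * v $ j)" by (rule sum.swap)
    also have "\<dots> = (\<Sum>z\<in>B. \<alpha> z * R z * z ^ i)"
      by (simp add: R_def sum_distrib_left sum_distrib_right power_add mult_ac)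
    finally show ?thesis .
  qed
  have R0: "R z = 0" if z: "z \<in> B" for z
  proof -
    define s where "s = (\<Prod>w\<in>B - {z}. [:- w, 1:])"
    have deg: "degree s < k"
    proof -
      have "degree s \<le> sum (degree \<circ> (\<lambda>w. [:- w, 1:])) (B - {z})"
        unfolding s_def by (rule degree_prod_sum_le) (use fin in auto)
      also have "\<dots> = card (B - {z})" by simp
      also have "\<dots> < k" using fin z card by (metis card_Diff1_less)
      finally show ?thesis .
    qed
    have "(\<Sum>w\<in>B. (\<alpha> w * R w) * poly s w * w ^ 0) = rec_op s (\<lambda>n. \<Sum>w\<in>B. (\<alpha> w * R w) * w ^ n) 0"
      by (rule rec_op_exp_sum[symmetric])
    also have "\<dots> = 0" unfolding rec_op_def by (rule sum.neutral) (use R deg in auto)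
    finally have "rec_op s (\<lambda>n. \<Sum>w\<in>B. (\<alpha> w * R w) * w ^ n) 0 = 0"
      by (simp only: rec_op_exp_sum)
    then have "\<alpha> z * R z * (\<Prod>w\<in>B - {z}. z - w) = 0"
      using rec_op_isolate[OF fin z, of "\<lambda>w. \<alpha> w * R w" 0] by (simp only: s_def) simp
    then show ?thesis using \<alpha>[OF z] fin by auto
  qed
  define \<rho> where "\<rho> = (\<Sum>j<k. monom (v $ j) j)"
  have coeff: "coeff \<rho> i = (if i < k then v $ i else 0)" for i
    by (simp add: \<rho>_def coeff_sum if_distrib[of "\<lambda>x. x = _"] cong: if_cong)
  have "\<rho> = 0"
  proof (rule ccontr)
    assume nz: "\<rho> \<noteq> 0"
    have "degree \<rho> < k"
    proof -
      have "coeff \<rho> (degree \<rho>) \<noteq> 0" using nz by simp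
      then show ?thesis using coeff[of "degree \<rho>"] by (metis (full_types))
    qed
    moreover have "card B \<le> card {z. poly \<rho> z = 0}"
      using R0 nz by (intro card_mono poly_roots_finite) (auto simp: \<rho>_def R_def poly_sum poly_monom)
    moreover have "card {z. poly \<rho> z = 0} \<le> degree \<rho>" using nz by (rule poly_roots_degree)
    ultimately show False using card by simp
  qed
  then have "v = 0\<^sub>v k" using v(1) coeff by (intro eq_vecI) (auto, metis coeff_0)
  then show False using v(2) by simp
qed

section \<open>Subset products and limits of n-th roots\<close>

text \<open>Replacing factors by \<open>max 1\<close> and enlarging the index set can only increase
  the product. Omitting an element with value above 1 costs a factor, which later separates the
  dominant subset from its competitors.\<close>

lemma prod_max_1_less:
  fixes f :: "'a \<Rightarrow> real"
  assumes "finite Z" "I \<subseteq> Z" "\<And>z. z \<in> Z \<Longrightarrow> f z \<ge> 0"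
  shows "(\<Prod>z\<in>I. f z) \<le> (\<Prod>z\<in>Z. max 1 (f z))"
    and "z \<in> Z \<Longrightarrow> z \<notin> I \<Longrightarrow> f z > 1 \<Longrightarrow> (\<Prod>z\<in>I. f z) < (\<Prod>z\<in>Z. max 1 (f z))"
proof -
  have fI: "finite I" using assms by (simp add: finite_subset)
  have "(\<Prod>z\<in>I. f z) \<le> (\<Prod>z\<in>I. max 1 (f z))" using assms by (intro prod_mono) auto
  moreover have Z: "(\<Prod>z\<in>Z. max 1 (f z)) = (\<Prod>z\<in>Z - I. max 1 (f z)) * (\<Prod>z\<in>I. max 1 (f z))"
    using assms by (intro prod.subset_diff) auto
  moreover have I1: "(\<Prod>z\<in>I. max 1 (f z)) \<ge> 1" by (intro prod_ge_1) auto
  moreover have "(\<Prod>z\<in>Z - I. max 1 (f z)) \<ge> 1" by (intro prod_ge_1) auto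
  ultimately show "(\<Prod>z\<in>I. f z) \<le> (\<Prod>z\<in>Z. max 1 (f z))"
    using mult_right_mono[of 1 "\<Prod>z\<in>Z - I. max 1 (f z)" "\<Prod>z\<in>I. max 1 (f z)"] by linarith
  assume z: "z \<in> Z" "z \<notin> I" "f z > 1"
  have "(\<Prod>z\<in>Z - I. max 1 (f z)) = max 1 (f z) * (\<Prod>z\<in>Z - I - {z}. max 1 (f z))"
    using assms z by (intro prod.remove) auto
  moreover have "(\<Prod>z\<in>Z - I - {z}. max 1 (f z)) \<ge> 1" by (intro prod_ge_1) auto
  ultimately have "(\<Prod>z\<in>Z - I. max 1 (f z)) > 1"
    using z mult_left_mono[of 1 "\<Prod>z\<in>Z - I - {z}. max 1 (f z)" "max 1 (f z)"] by linarith
  then show "(\<Prod>z\<in>I. f z) < (\<Prod>z\<in>Z. max 1 (f z))"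
    using \<open>(\<Prod>z\<in>I. f z) \<le> (\<Prod>z\<in>I. max 1 (f z))\<close> I1
      mult_strict_right_mono[of 1 "\<Prod>z\<in>Z - I. max 1 (f z)" "\<Prod>z\<in>I. max 1 (f z)"] Z by linarith
qed

lemma powr_inverse_tendsto:
  assumes "c > 0" "M > 0"
  shows "(\<lambda>n. (c * M ^ n) powr (1 / real n)) \<longlonglongrightarrow> M"
proof -
  have "(\<lambda>n. c powr (1 / real n) * M) \<longlonglongrightarrow> c powr 0 * M"
    using assms by (intro tendsto_intros lim_1_over_n) auto
  \<comment> \<open>Only eventually: at \<open>n = 0\<close> the exponent \<open>1 / real n\<close>
    is 0 and the two sides can differ.\<close>
  moreover have "eventually (\<lambda>n. c powr (1 / real n) * M = (c * M ^ n) powr (1 / real n)) sequentially"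
    using eventually_gt_at_top[of 0]
    by eventually_elim (use assms in \<open>simp add: powr_mult powr_realpow[symmetric] powr_powr\<close>)
  ultimately show ?thesis using assms by (simp add: tendsto_cong)
qed

lemma limsup_root_le:
  assumes "M > 0" "\<And>n. 0 \<le> d n" "\<And>n. d n \<le> K * M ^ n"
  shows "limsup (\<lambda>n. ereal (d n powr (1 / real n))) \<le> ereal M"
proof -
  \<comment> \<open>\<open>K\<close> may be 0, while the limit of roots needs a positive
    constant.\<close>
  define c where "c = max K 1"
  have c: "c > 0" by (simp add: c_def)
  have "K * M ^ n \<le> c * M ^ n" for n
    using assms(1) by (intro mult_right_mono) (auto simp: c_def)
  then have d: "d n \<le> c * M ^ n" for n using assms(3) order_trans by blast
  have "limsup (\<lambda>n. ereal (d n powr (1 / real n))) \<le> limsup (\<lambda>n. ereal ((c * M ^ n) powr (1 / real n)))"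
    using assms(2) d by (intro Limsup_mono always_eventually) (auto intro!: powr_mono2)
  also have "\<dots> = ereal M"
    by (intro lim_imp_Limsup tendsto_ereal powr_inverse_tendsto) (use c assms in auto)
  finally show ?thesis .
qed

lemma limsup_root_ge:
  assumes "M > 0" "c > 0" "eventually (\<lambda>n. c * M ^ n \<le> d n) sequentially"
  shows "ereal M \<le> limsup (\<lambda>n. ereal (d n powr (1 / real n)))"
proof -
  have "ereal M = limsup (\<lambda>n. ereal ((c * M ^ n) powr (1 / real n)))"
    by (intro lim_imp_Limsup[symmetric] tendsto_ereal powr_inverse_tendsto) (use assms in auto)
  also have "\<dots> \<le> limsup (\<lambda>n. ereal (d n powr (1 / real n)))"
    by (intro Limsup_mono, rule eventually_mono[OF assms(3)])
      (use assms in \<open>auto intro!: powr_mono2\<close>)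
  finally show ?thesis .
qed

text \<open>\<open>Z\<close> is the exact support. Nonzero coefficients make the product over
  \<open>Z\<close> minimal and keep the leading part of the Hankel determinant from
  vanishing.\<close>

locale exp_sum_seq =
  fixes a :: "nat \<Rightarrow> real" and \<alpha> :: "complex \<Rightarrow> complex" and Z :: "complex set"
  assumes fin: "finite Z" and coeff_nz: "\<And>z. z \<in> Z \<Longrightarrow> \<alpha> z \<noteq> 0"
    and expansion: "\<And>n. complex_of_real (a n) = (\<Sum>z\<in>Z. \<alpha> z * z ^ n)"
begin

text \<open>The Mahler measure of the monic polynomial with simple roots \<open>Z\<close>.\<close>

definition M where "M = (\<Prod>z\<in>Z. max 1 (cmod z))"

lemma M_ge_1: "M \<ge> 1"
  unfolding M_def by (intro prod_ge_1) auto

lemma abs_det_hankel: "\<bar>det (hankel a n k)\<bar>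
    = cmod (\<Sum>g\<in>{..<k} \<rightarrow>\<^sub>E Z. hankel_coeff k \<alpha> g * (\<Prod>i<k. g i) ^ n)"
proof -
  have "map_mat complex_of_real (hankel a n k) = exp_hankel k \<alpha> Z n"
    by (rule eq_matI) (auto simp: hankel_def exp_hankel_def expansion)
  then have "complex_of_real (det (hankel a n k)) = det (exp_hankel k \<alpha> Z n)"
    by (simp flip: of_real_hom.hom_det)
  then show ?thesis by (metis det_exp_hankel[OF fin] norm_of_real)
qed

lemma finite_PiE_Z: "finite ({..<k} \<rightarrow>\<^sub>E Z)" for k :: nat
  using fin by (intro finite_PiE) auto

lemma cmod_prod_image:
  "inj_on g {..<k} \<Longrightarrow> cmod (\<Prod>i<k. g i) = (\<Prod>z\<in>g ` {..<k}. cmod z)"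
  by (simp add: prod_norm[symmetric] prod.reindex)

text \<open>Choices with a repeated base have coefficient zero; the others grow like products over
  subsets of \<open>Z\<close>, at most \<open>M\<close>.\<close>

lemma GR_le: "GR k a \<le> ereal M"
proof (cases "k = 0")
  case True
  then show ?thesis using M_ge_1 by (simp add: GR_def one_ereal_def)
next
  case False
  have "\<bar>det (hankel a n k)\<bar> \<le> (\<Sum>g\<in>{..<k} \<rightarrow>\<^sub>E Z. cmod (hankel_coeff k \<alpha> g)) * M ^ n" for n
  proof -
    have "\<bar>det (hankel a n k)\<bar> \<le> (\<Sum>g\<in>{..<k} \<rightarrow>\<^sub>E Z. cmod (hankel_coeff k \<alpha> g) * M ^ n)"
      unfolding abs_det_hankel
    proof (rule sum_norm_le)
      fix g assume g: "g \<in> {..<k} \<rightarrow>\<^sub>E Z"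
      show "cmod (hankel_coeff k \<alpha> g * (\<Prod>i<k. g i) ^ n) \<le> cmod (hankel_coeff k \<alpha> g) * M ^ n"
      proof (cases "inj_on g {..<k}")
        case True
        have "cmod (\<Prod>i<k. g i) \<le> M"
          unfolding cmod_prod_image[OF True] M_def
          by (rule prod_max_1_less(1)[OF fin]) (use g in auto)
        then show ?thesis
          by (simp add: norm_mult norm_power mult_left_mono power_mono)
      qed (simp add: hankel_coeff_not_inj)
    qed
    then show ?thesis by (simp add: sum_distrib_right)
  qed
  then show ?thesis
    using False M_ge_1 unfolding GR_def by (auto intro!: limsup_root_le)
qed

text \<open>For \<open>k\<close> take the number of bases outside the unit circle. All enumerations
  of \<open>B\<close> have the same product \<open>\<beta>\<close> of modulus \<open>M\<close>, and
  their coefficients add up to the determinant \<open>C\<close> over \<open>B\<close>, which is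
  nonzero. Every other contributing choice misses a base from \<open>B\<close> and is exponentially
  smaller.\<close>

lemma GR_eq: "\<exists>k. GR k a = ereal M"
proof -
  define B where "B = {z\<in>Z. 1 < cmod z}"
  define k where "k = card B"
  have finB: "finite B" using fin by (simp add: B_def)
  have M_B: "M = (\<Prod>z\<in>B. cmod z)"
  proof -
    have "(\<Prod>z\<in>Z. max 1 (cmod z)) = (\<Prod>z\<in>B. max 1 (cmod z))"
      by (rule prod.mono_neutral_right) (use fin in \<open>auto simp: B_def\<close>)
    also have "\<dots> = (\<Prod>z\<in>B. cmod z)" by (rule prod.cong) (auto simp: B_def)
    finally show ?thesis by (simp add: M_def)
  qed
  show ?thesis
  proof (cases "k = 0")
    \<comment> \<open>Without bases outside the unit circle the maximum is attained at
      \<open>k = 0\<close>, by the convention for \<open>GR\<close>.\<close>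
    case True
    then have "M = 1" using finB by (simp add: M_B k_def)
    then show ?thesis by (intro exI[of _ 0]) (simp add: GR_def one_ereal_def)
  next
    case False
    define \<beta> where "\<beta> = (\<Prod>z\<in>B. z)"
    have cmod_\<beta>: "cmod \<beta> = M" by (simp add: \<beta>_def M_B prod_norm)
    let ?E = "{..<k} \<rightarrow>\<^sub>E Z" and ?D = "{..<k} \<rightarrow>\<^sub>E B"
    let ?c = "hankel_coeff k \<alpha>"
    define C where "C = (\<Sum>g\<in>?D. ?c g)"
    have bij: "g ` {..<k} = B" if "g \<in> ?D" "inj_on g {..<k}" for g
    proof (rule card_subset_eq[OF finB])
      show "g ` {..<k} \<subseteq> B" using that by auto
      show "card (g ` {..<k}) = card B" using that by (simp add: card_image k_def)
    qed
    have prod_\<beta>: "?c g * (\<Prod>i<k. g i) ^ n = ?c g * \<beta> ^ n" if "g \<in> ?D" for g n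
    proof (cases "inj_on g {..<k}")
      case True
      then have "(\<Prod>i<k. g i) = \<beta>"
        using bij[OF that True] prod.reindex[OF True, of "\<lambda>z. z"] by (simp add: \<beta>_def)
      then show ?thesis by simp
    qed (simp add: hankel_coeff_not_inj)
    have C: "C \<noteq> 0"
    proof -
      have "det (exp_hankel k \<alpha> B 0) = C"
        by (simp add: det_exp_hankel[OF finB] C_def)
      then show ?thesis
        using det_exp_hankel_full[OF finB, of k \<alpha>] coeff_nz by (auto simp: k_def B_def)
    qed
    define R where "R n = (\<Sum>g\<in>?E - ?D. ?c g * (\<Prod>i<k. g i) ^ n)" for n
    have DE: "?D \<subseteq> ?E" by (intro PiE_mono) (auto simp: B_def)
    have det: "\<bar>det (hankel a n k)\<bar> = cmod (C * \<beta> ^ n + R n)" for n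
    proof -
      have "(\<Sum>g\<in>?E. ?c g * (\<Prod>i<k. g i) ^ n) = R n + (\<Sum>g\<in>?D. ?c g * (\<Prod>i<k. g i) ^ n)"
        unfolding R_def by (rule sum.subset_diff[OF DE finite_PiE_Z])
      also have "(\<Sum>g\<in>?D. ?c g * (\<Prod>i<k. g i) ^ n) = C * \<beta> ^ n"
        unfolding C_def sum_distrib_right by (rule sum.cong[OF refl prod_\<beta>])
      finally show ?thesis by (simp add: abs_det_hankel add.commute)
    qed
    have "(\<lambda>n. R n / \<beta> ^ n) \<longlonglongrightarrow> (\<Sum>g\<in>?E - ?D. 0)"
    proof -
      have "(\<lambda>n. ?c g * (\<Prod>i<k. g i) ^ n / \<beta> ^ n) \<longlonglongrightarrow> 0" if g: "g \<in> ?E - ?D" for g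
      proof (cases "inj_on g {..<k}")
        case True
        have "\<not> g ` {..<k} \<subseteq> B" using g by auto
        \<comment> \<open>An injective choice of size \<open>k\<close> containing \<open>B\<close>
          would be an enumeration of \<open>B\<close>, so this choice omits some element of
          \<open>B\<close>.\<close>
        moreover have "B = g ` {..<k}" if "B \<subseteq> g ` {..<k}"
          by (rule card_subset_eq[OF _ that]) (simp_all add: card_image[OF True] k_def[symmetric])
        ultimately have "\<not> B \<subseteq> g ` {..<k}" by blast
        then obtain z where z: "z \<in> B" "z \<notin> g ` {..<k}" by blast
        have "cmod (\<Prod>i<k. g i) < M"
          unfolding cmod_prod_image[OF True] M_def
          by (rule prod_max_1_less(2)[OF fin _ _ _ z(2)]) (use g z in \<open>auto simp: B_def\<close>)
        then have "(\<lambda>n. ((\<Prod>i<k. g i) / \<beta>) ^ n) \<longlonglongrightarrow> 0"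
          using M_ge_1 by (intro LIMSEQ_power_zero) (simp add: norm_divide cmod_\<beta>)
        then have "(\<lambda>n. ?c g * ((\<Prod>i<k. g i) / \<beta>) ^ n) \<longlonglongrightarrow> ?c g * 0"
          by (rule tendsto_mult_left)
        then show ?thesis by (simp add: power_divide)
      qed (simp add: hankel_coeff_not_inj)
      then show ?thesis unfolding R_def sum_divide_distrib by (intro tendsto_sum)
    qed
    then have "(\<lambda>n. cmod (C + R n / \<beta> ^ n)) \<longlonglongrightarrow> cmod (C + 0)" by (intro tendsto_intros) simp
    then have "eventually (\<lambda>n. cmod C / 2 < cmod (C + R n / \<beta> ^ n)) sequentially"
      using C by (intro order_tendstoD(1)) auto
    then have "eventually (\<lambda>n. cmod C / 2 * M ^ n \<le> \<bar>det (hankel a n k)\<bar>) sequentially"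
    proof eventually_elim
      case (elim n)
      have "\<beta> \<noteq> 0" using cmod_\<beta> M_ge_1 by auto
      then have "R n / \<beta> ^ n * \<beta> ^ n = R n" by simp
      then have "C * \<beta> ^ n + R n = (C + R n / \<beta> ^ n) * \<beta> ^ n"
        by (simp only: distrib_right)
      then have "\<bar>det (hankel a n k)\<bar> = cmod (C + R n / \<beta> ^ n) * M ^ n"
        by (simp add: det norm_mult norm_power cmod_\<beta>)
      then show ?case using elim M_ge_1 by (simp add: mult_right_mono)
    qed
    then have "ereal M \<le> limsup (\<lambda>n. ereal (\<bar>det (hankel a n k)\<bar> powr (1 / real n)))"
      by (rule limsup_root_ge[rotated 2]) (use M_ge_1 C in auto)
    then have "ereal M \<le> GR k a" using False by (simp add: GR_def)
    then show ?thesis using GR_le[of k] by (intro exI[of _ k]) auto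
  qed
qed

end

section \<open>Sequences dominated by the Perron root\<close>

text \<open>Hermite's identity: for \<open>x = M * q + t\<close> with remainder \<open>t\<close>,
  exactly the last \<open>t\<close> shifts \<open>j\<close> carry over to \<open>q + 1\<close>. So a
  value splits into \<open>M\<close> nearly equal integer parts without loss.\<close>

lemma sum_div_shift:
  fixes x :: int
  assumes "M > 0"
  shows "(\<Sum>j<M. (x + int j) div int M) = x"
proof -
  define q t where "q = x div int M" and "t = nat (x mod int M)"
  have t: "t < M" using assms by (simp add: t_def nat_less_iff)
  have x: "x = int M * q + int t" using assms by (simp add: q_def t_def)
  have "(x + int j) div int M = q + (if M - t \<le> j then 1 else 0)" if "j < M" for j
  proof -
    have "(x + int j) div int M = q + (int t + int j) div int M"
      using assms by (simp add: x add.assoc)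
    also have "(int t + int j) div int M = (if M - t \<le> j then 1 else 0)"
    proof (cases "M - t \<le> j")
      case True
      define s where "s = t + j - M"
      have s: "t + j = M + s" using True by (simp add: s_def)
      then have "int t + int j = int s + int M" "s < M" using t that by linarith+
      then have "(int t + int j) div int M = 1" using assms by simp
      then show ?thesis using True by simp
    next
      case False
      then have "int t + int j < int M" by simp
      then show ?thesis using False by simp
    qed
    finally show ?thesis .
  qed
  then have "(\<Sum>j<M. (x + int j) div int M) = (\<Sum>j<M. q + (if M - t \<le> j then 1 else 0))"
    by (intro sum.cong) auto
  also have "\<dots> = int M * q + int (card {j. j < M \<and> M - t \<le> j})"
    by (simp add: sum.distrib sum.If_cases Int_def)
  also have "{j. j < M \<and> M - t \<le> j} = {M - t..<M}" by auto
  finally show ?thesis using t x by simp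
qed

text \<open>The radius \<open>r\<close> leaves a gap between \<open>lam\<close> and all other roots,
  and \<open>zs\<close> is a list, so multiplicities are harmless. The case \<open>lam = 1\<close>
  is treated apart.\<close>

locale perron_factorization =
  fixes p :: "int poly" and q :: "real poly" and lam r :: real and zs :: "complex list"
  assumes monic: "lead_coeff p = 1"
    and p_fac: "map_poly real_of_int p = [:- lam, 1:] * q"
    and q_fac: "map_poly complex_of_real q = (\<Prod>z\<leftarrow>zs. [:- z, 1:])"
    and zs: "\<And>z. z \<in> set zs \<Longrightarrow> cmod z < r"
    and r: "0 < r" "r < lam"
    and lam: "1 < lam"
begin

abbreviation killed :: "(nat \<Rightarrow> real) \<Rightarrow> bool" where
  "killed e \<equiv> (\<forall>n. rec_op (map_poly real_of_int p) e n = 0)"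

text \<open>The coefficient of \<open>lam ^ n\<close> in a sequence killed by \<open>p\<close>.\<close>

definition dom_coeff :: "(nat \<Rightarrow> real) \<Rightarrow> real" where
  "dom_coeff e = rec_op q e 0 / poly q lam"

lemma poly_q_lam: "poly q lam \<noteq> 0"
proof -
  have "complex_of_real (poly q lam) = poly (\<Prod>z\<leftarrow>zs. [:- z, 1:]) (complex_of_real lam)"
    by (simp only: q_fac[symmetric] of_real_hom.poly_map_poly)
  moreover have "poly (\<Prod>z\<leftarrow>zs. [:- z, 1:]) (complex_of_real lam) \<noteq> 0"
  proof -
    have "complex_of_real lam \<notin> set zs" using zs r lam by force
    then show ?thesis by (auto simp: poly_prod_list prod_list_zero_iff)
  qed
  ultimately show ?thesis by auto
qed

lemma degree_p: "degree p = Suc (degree q)" and monic_q: "lead_coeff q = 1"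
proof -
  have "q \<noteq> 0" using poly_q_lam by auto
  have "degree p = degree (map_poly real_of_int p)" by simp
  also have "\<dots> = degree [:- lam, 1:] + degree q"
    unfolding p_fac using \<open>q \<noteq> 0\<close> by (intro degree_mult_eq) auto
  finally show "degree p = Suc (degree q)" by simp
  have "lead_coeff (map_poly real_of_int p) = 1" using monic by simp
  then show "lead_coeff q = 1" unfolding p_fac lead_coeff_mult by simp
qed

lemma dom_coeff_diff: "dom_coeff (\<lambda>n. e n - f n) = dom_coeff e - dom_coeff f"
  by (simp add: dom_coeff_def rec_op_seq_diff diff_divide_distrib)

lemma dom_coeff_cmult: "dom_coeff (\<lambda>n. c * e n) = c * dom_coeff e"
  by (simp add: dom_coeff_def rec_op_seq_cmult)

lemma dom_coeff_sum: "dom_coeff (\<lambda>n. \<Sum>i\<in>I. e i n) = (\<Sum>i\<in>I. dom_coeff (e i))"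
  by (simp add: dom_coeff_def rec_op_seq_sum sum_divide_distrib)

text \<open>Applying \<open>q\<close> leaves a sequence killed by the single factor with root
  \<open>lam\<close>, hence a geometric one.\<close>

lemma rec_op_q:
  assumes "killed e" shows "rec_op q e n = dom_coeff e * poly q lam * lam ^ n"
proof (induction n)
  case 0
  show ?case using poly_q_lam by (simp add: dom_coeff_def)
next
  case (Suc n)
  have "rec_op [:- lam, 1:] (rec_op q e) n = 0"
    using assms by (simp only: p_fac rec_op_mult[symmetric])
  then have "rec_op q e (Suc n) - lam * rec_op q e n = 0" by (simp only: rec_op_linear_factor)
  then show ?case using Suc by simp
qed

lemma dom_coeff_shift:
  assumes "killed e" shows "dom_coeff (\<lambda>n. e (n + m)) = lam ^ m * dom_coeff e"
  using rec_op_q[OF assms, of m] rec_op_shift[of q e m 0] poly_q_lam by (simp add: dom_coeff_def[of "\<lambda>n. e (n + m)"])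

lemma killed_shift: "killed e \<Longrightarrow> killed (\<lambda>n. e (n + m))"
  by (simp add: rec_op_shift)

lemma killed_diff: "killed e \<Longrightarrow> killed f \<Longrightarrow> killed (\<lambda>n. e n - f n)"
  by (simp add: rec_op_seq_diff)

lemma killed_cmult: "killed e \<Longrightarrow> killed (\<lambda>n. c * e n)"
  by (simp add: rec_op_seq_cmult)

lemma killed_of_int: "(\<And>n. rec_op p e n = 0) \<Longrightarrow> killed (\<lambda>n. real_of_int (e n))"
  by (simp add: rec_op_of_int)

text \<open>Subtracting the \<open>lam ^ n\<close> term leaves a sequence killed by
  \<open>q\<close>, all of whose roots lie below \<open>r\<close> in modulus.\<close>

lemma dominant:
  assumes "killed e"
  shows "\<exists>C. \<forall>n. \<bar>e n - dom_coeff e * lam ^ n\<bar> \<le> C * r ^ n"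
proof -
  define w where "w n = e n - dom_coeff e * lam ^ n" for n
  have "rec_op q w n = 0" for n
    unfolding w_def by (simp add: rec_op_seq_diff rec_op_seq_cmult rec_op_geometric rec_op_q[OF assms])
  then have "rec_op (\<Prod>z\<leftarrow>zs. [:- z, 1:]) (\<lambda>n. complex_of_real (w n)) n = 0" for n
    by (simp only: q_fac[symmetric] rec_op_of_real) simp
  from rec_op_growth[OF this zs r(1)] show ?thesis by (simp only: norm_of_real w_def)
qed

text \<open>The sequences killed by \<open>p\<close> form a finite-dimensional space; in the basis
  \<open>u i\<close> of unit initial values the coordinates are at most 1 in absolute value, so the
  constants of the basis add up. This will control rounding errors.\<close>

lemma dominant_uniform:
  shows "\<exists>C>0. \<forall>e. killed e \<longrightarrow> (\<forall>i<degree p. \<bar>e i\<bar> \<le> 1) \<longrightarrow>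
           \<bar>dom_coeff e\<bar> \<le> C \<and> (\<forall>n. \<bar>e n - dom_coeff e * lam ^ n\<bar> \<le> C * r ^ n)"
proof -
  let ?P = "map_poly real_of_int p" and ?d = "degree p"
  have monicP: "lead_coeff ?P = 1" and degP: "degree ?P = ?d" using monic by simp_all
  define u where "u i = rec_seq ?P (\<lambda>j. if j = i then 1 else 0)" for i
  have ku: "killed (u i)" for i
    by (simp add: u_def rec_op_rec_seq[OF monicP])
  have "\<forall>i. \<exists>C. \<forall>n. \<bar>u i n - dom_coeff (u i) * lam ^ n\<bar> \<le> C * r ^ n" using dominant[OF ku] by blast
  then obtain D where D: "\<And>i n. \<bar>u i n - dom_coeff (u i) * lam ^ n\<bar> \<le> D i * r ^ n" by metis
  have D0: "D i \<ge> 0" for i using D[of i 0] by simp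
  \<comment> \<open>The summand 1 only ensures that \<open>C\<close> is positive.\<close>
  define C where "C = 1 + (\<Sum>i<?d. D i + \<bar>dom_coeff (u i)\<bar>)"
  have C: "(\<Sum>i<?d. \<bar>dom_coeff (u i)\<bar>) \<le> C" "(\<Sum>i<?d. D i) \<le> C" "0 < C"
  proof -
    have "(\<Sum>i<?d. \<bar>dom_coeff (u i)\<bar>) \<ge> 0" "(\<Sum>i<?d. D i) \<ge> 0"
      using D0 by (simp_all add: sum_nonneg)
    moreover have "C = 1 + ((\<Sum>i<?d. D i) + (\<Sum>i<?d. \<bar>dom_coeff (u i)\<bar>))"
      by (simp only: C_def sum.distrib)
    ultimately show "(\<Sum>i<?d. \<bar>dom_coeff (u i)\<bar>) \<le> C" "(\<Sum>i<?d. D i) \<le> C" "0 < C"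
      by linarith+
  qed
  have "\<bar>dom_coeff e\<bar> \<le> C \<and> (\<forall>n. \<bar>e n - dom_coeff e * lam ^ n\<bar> \<le> C * r ^ n)"
    if e: "killed e" "\<forall>i<?d. \<bar>e i\<bar> \<le> 1" for e
  proof -
    have kd: "rec_op ?P (\<lambda>n. e n - (\<Sum>i<?d. e i * u i n)) n = 0" for n
      using e(1) ku by (simp add: rec_op_seq_diff rec_op_seq_sum rec_op_seq_cmult)
    have e0: "e n - (\<Sum>i<?d. e i * u i n) = 0" for n
    proof (rule rec_op_zero_unique[OF monicP kd])
      fix j assume j: "j < degree ?P"
      have "(\<Sum>i<?d. e i * u i j) = (\<Sum>i<?d. if i = j then e i else 0)"
        by (rule sum.cong) (use j in \<open>auto simp: u_def rec_seq_init\<close>)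
      then show "e j - (\<Sum>i<?d. e i * u i j) = 0" using j by simp
    qed
    have e_n: "e n = (\<Sum>i<?d. e i * u i n)" for n
      by (rule eq_iff_diff_eq_0[THEN iffD2, OF e0])
    then have e_eq: "e = (\<lambda>n. \<Sum>i<?d. e i * u i n)" by (rule ext)
    have dom_coeff_e: "dom_coeff e = (\<Sum>i<?d. e i * dom_coeff (u i))"
      by (subst e_eq) (simp only: dom_coeff_sum dom_coeff_cmult)
    have "\<bar>dom_coeff e\<bar> \<le> (\<Sum>i<?d. \<bar>e i * dom_coeff (u i)\<bar>)" unfolding dom_coeff_e by (rule sum_abs)
    also have "\<dots> \<le> (\<Sum>i<?d. \<bar>dom_coeff (u i)\<bar>)"
      by (intro sum_mono) (use e(2) in \<open>auto simp: abs_mult intro: mult_left_le_one_le\<close>)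
    finally have "\<bar>dom_coeff e\<bar> \<le> C" using C(1) by linarith
    moreover have "\<bar>e n - dom_coeff e * lam ^ n\<bar> \<le> C * r ^ n" for n
    proof -
      have "(\<Sum>i<?d. e i * (u i n - dom_coeff (u i) * lam ^ n))
          = (\<Sum>i<?d. e i * u i n) - (\<Sum>i<?d. e i * dom_coeff (u i)) * lam ^ n"
        by (simp add: sum_distrib_right right_diff_distrib sum_subtractf mult.assoc)
      then have "e n - dom_coeff e * lam ^ n = (\<Sum>i<?d. e i * (u i n - dom_coeff (u i) * lam ^ n))"
        by (simp only: e_n[symmetric] dom_coeff_e[symmetric])
      also have "\<bar>\<dots>\<bar> \<le> (\<Sum>i<?d. \<bar>e i * (u i n - dom_coeff (u i) * lam ^ n)\<bar>)" by (rule sum_abs)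
      also have "\<dots> \<le> (\<Sum>i<?d. D i * r ^ n)"
      proof (intro sum_mono)
        fix i assume "i \<in> {..<?d}"
        then have "\<bar>e i\<bar> * \<bar>u i n - dom_coeff (u i) * lam ^ n\<bar> \<le> 1 * (D i * r ^ n)"
          using e(2) by (intro mult_mono D) auto
        then show "\<bar>e i * (u i n - dom_coeff (u i) * lam ^ n)\<bar> \<le> D i * r ^ n" by (simp add: abs_mult)
      qed
      also have "\<dots> \<le> C * r ^ n"
        using C(2) r by (simp add: sum_distrib_right[symmetric] mult_right_mono)
      finally show ?thesis .
    qed
    ultimately show ?thesis by blast
  qed
  then show ?thesis using C(3) by blast
qed

text \<open>The deviation is measured relative to \<open>dom_coeff e\<close>, so the condition is
  invariant under positive scaling, in particular under division by \<open>M\<close>.\<close>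

definition cone :: "real \<Rightarrow> (nat \<Rightarrow> real) \<Rightarrow> bool" where
  "cone dl e \<longleftrightarrow> killed e \<and> 0 < dom_coeff e \<and> (\<forall>n. \<bar>e n - dom_coeff e * lam ^ n\<bar> \<le> dl * dom_coeff e * r ^ n)"

lemma cone_killed: "cone dl e \<Longrightarrow> killed e" and cone_pos: "cone dl e \<Longrightarrow> 0 < dom_coeff e"
  and cone_bound: "cone dl e \<Longrightarrow> \<bar>e n - dom_coeff e * lam ^ n\<bar> \<le> dl * dom_coeff e * r ^ n"
  by (simp_all add: cone_def)

text \<open>The integer solution with last initial value 1 and the others 0 has nonzero dominant
  coefficient. After a sign change and a long shift its relative deviation falls below
  \<open>dl\<close>.\<close>

lemma cone_exists:
  assumes "0 < dl"
  shows "\<exists>b :: nat \<Rightarrow> int. cone dl (\<lambda>n. real_of_int (b n))"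
proof -
  define e where "e = rec_seq p (\<lambda>i. if i = degree q then 1 else (0::int))"
  define er where "er n = real_of_int (e n)" for n
  have ke: "killed er"
    unfolding er_def by (rule killed_of_int) (simp add: e_def rec_op_rec_seq[OF monic])
  have "rec_op q er 0 = (\<Sum>j<degree q. coeff q j * er j) + er (degree q)"
    by (simp add: rec_op_monic[OF monic_q])
  also have "(\<Sum>j<degree q. coeff q j * er j) = 0"
    by (rule sum.neutral) (auto simp: er_def e_def rec_seq_init degree_p)
  also have "er (degree q) = 1" by (simp add: er_def e_def rec_seq_init degree_p)
  finally have th0: "dom_coeff er \<noteq> 0" using poly_q_lam by (simp add: dom_coeff_def)
  define \<sigma> :: int where "\<sigma> = (if dom_coeff er > 0 then 1 else -1)"
  have \<sigma>: "real_of_int \<sigma> * dom_coeff er = \<bar>dom_coeff er\<bar>" "\<bar>real_of_int \<sigma>\<bar> = 1" by (auto simp: \<sigma>_def)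
  obtain C where C: "\<And>n. \<bar>er n - dom_coeff er * lam ^ n\<bar> \<le> C * r ^ n" using dominant[OF ke] by blast
  have C0: "C \<ge> 0" using C[of 0] by simp
  \<comment> \<open>A shift by \<open>N\<close> scales the dominant part by \<open>lam ^ N\<close>
    but the deviation bound only by \<open>r ^ N\<close>.\<close>
  have "(\<lambda>N. C * (r / lam) ^ N) \<longlonglongrightarrow> C * 0"
    by (intro tendsto_intros LIMSEQ_realpow_zero) (use r in auto)
  then have "eventually (\<lambda>N. C * (r / lam) ^ N < dl * \<bar>dom_coeff er\<bar>) sequentially"
    using assms th0 by (intro order_tendstoD(2)) auto
  then obtain N where N: "C * (r / lam) ^ N < dl * \<bar>dom_coeff er\<bar>"
    by (auto simp: eventually_sequentially)
  then have N': "C * r ^ N \<le> dl * \<bar>dom_coeff er\<bar> * lam ^ N"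
    using lam by (simp add: power_divide field_simps)
  define b where "b n = \<sigma> * e (n + N)" for n
  have b: "(\<lambda>n. real_of_int (b n)) = (\<lambda>n. real_of_int \<sigma> * er (n + N))"
    by (simp add: b_def er_def)
  have "dom_coeff (\<lambda>n. real_of_int (b n)) = real_of_int \<sigma> * (lam ^ N * dom_coeff er)"
    unfolding b by (subst dom_coeff_cmult) (simp only: dom_coeff_shift[OF ke])
  then have thb: "dom_coeff (\<lambda>n. real_of_int (b n)) = lam ^ N * \<bar>dom_coeff er\<bar>"
    using \<sigma>(1) by (simp add: algebra_simps)
  have "\<bar>real_of_int (b n) - lam ^ N * \<bar>dom_coeff er\<bar> * lam ^ n\<bar> \<le> dl * (lam ^ N * \<bar>dom_coeff er\<bar>) * r ^ n" for n
  proof -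
    have "real_of_int (b n) - lam ^ N * \<bar>dom_coeff er\<bar> * lam ^ n
        = real_of_int \<sigma> * (er (n + N) - dom_coeff er * lam ^ (n + N))"
      by (simp add: b_def er_def \<sigma>(1)[symmetric] algebra_simps power_add)
    then have "\<bar>real_of_int (b n) - lam ^ N * \<bar>dom_coeff er\<bar> * lam ^ n\<bar> \<le> C * r ^ (n + N)"
      using C[of "n + N"] by (simp add: abs_mult \<sigma>(2))
    also have "\<dots> = (C * r ^ N) * r ^ n" by (simp add: power_add)
    also have "\<dots> \<le> (dl * \<bar>dom_coeff er\<bar> * lam ^ N) * r ^ n"
      using N' r by (intro mult_right_mono) auto
    finally show ?thesis by (simp add: algebra_simps)
  qed
  moreover have "killed (\<lambda>n. real_of_int (b n))"
    unfolding b by (intro killed_cmult killed_shift ke)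
  ultimately show ?thesis
    using th0 lam by (intro exI[of _ b]) (auto simp: cone_def thb)
qed

end

section \<open>A finite family closed under shifting and splitting\<close>

text \<open>The last condition on \<open>dl\<close> preserves monotonicity where the free values
  meet the first increment. \<open>mu ^ (k - 1) / 4\<close> is the lower bound for weight divided by
  \<open>M\<close> when \<open>M\<close> is at least 2; \<open>k_large\<close> makes the rounding
  error \<open>C\<close> small against it in each of the three margins.\<close>

locale perron_constants = perron_factorization +
  fixes dl mu nu C :: real and k :: nat
  assumes dl: "0 < dl" "dl \<le> 1 / 2" "1 + dl \<le> (1 - dl) * mu"
    and mu: "1 < mu" "r < mu" "mu < lam" and nu: "lam < nu"
    and C_pos: "0 < C"
    and C: "\<And>e. killed e \<Longrightarrow> (\<forall>i<degree p. \<bar>e i\<bar> \<le> 1) \<Longrightarrow>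
           \<bar>dom_coeff e\<bar> \<le> C \<and> (\<forall>n. \<bar>e n - dom_coeff e * lam ^ n\<bar> \<le> C * r ^ n)"
    and k_pos: "0 < k"
    and k_large: "C \<le> (lam - mu) * (mu ^ (k - 1) / 4)" "C \<le> (nu - lam) * (mu ^ (k - 1) / 4)"
      "C \<le> dl * (mu - r) * (mu ^ (k - 1) / 4)"
begin

text \<open>The rounding error \<open>e\<close> is killed by \<open>p\<close> with initial values at
  most 1, hence bounded by \<open>C\<close>. A shift multiplies the deviation bound by
  \<open>r\<close> but the dominant coefficient by \<open>lam\<close>, so narrowing leaves a margin
  \<open>dl * (mu - r)\<close> that absorbs the error.\<close>

lemma cone_divide:
  fixes M :: nat
  assumes b: "cone dl b" and M: "M \<ge> 1" and b': "killed b'"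
    and close: "\<And>i. i < degree p \<Longrightarrow> \<bar>b' i - b (i + 1) / M\<bar> \<le> 1"
    and exact: "\<And>i. M = 1 \<Longrightarrow> i < degree p \<Longrightarrow> b' i = b (i + 1)"
    and large: "M \<ge> 2 \<Longrightarrow> mu ^ (k - 1) / 4 \<le> dom_coeff b / M"
  shows "cone dl b'" "mu * dom_coeff b / M \<le> dom_coeff b'" "dom_coeff b' \<le> nu * dom_coeff b / M"
proof -
  define e where "e n = b' n - b (n + 1) / M" for n
  have kb: "killed b" using b by (rule cone_killed)
  have ke: "killed e"
    unfolding e_def using killed_diff[OF b' killed_cmult[OF killed_shift[OF kb, of 1], of "1 / M"]] by simp
  have the: "dom_coeff e = dom_coeff b' - lam * dom_coeff b / M"
    unfolding e_def using dom_coeff_diff[of b' "\<lambda>n. 1 / M * b (n + 1)"] dom_coeff_shift[OF kb, of 1]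
    by (simp only: dom_coeff_cmult) simp
  define t where "t = dom_coeff b / M"
  have t: "t > 0" using cone_pos[OF b] M by (simp add: t_def)
  obtain E where E: "E \<ge> 0" "\<bar>dom_coeff e\<bar> \<le> E" "\<And>n. \<bar>e n - dom_coeff e * lam ^ n\<bar> \<le> E * r ^ n"
    "E \<le> (lam - mu) * t" "E \<le> (nu - lam) * t" "E \<le> dl * (mu - r) * t"
  proof (cases "M = 1")
    \<comment> \<open>Division by 1 rounds nothing, so the error is exactly 0 and no lower bound on
      the weight is required.\<close>
    case True
    let ?P = "map_poly real_of_int p"
    have "e n = 0" for n
    proof (rule rec_op_zero_unique)
      show "lead_coeff ?P = 1" using monic by simp
      show "rec_op ?P e n = 0" for n using ke by simp
      show "i < degree ?P \<Longrightarrow> e i = 0" for i using exact[OF True] True by (simp add: e_def)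
    qed
    then have e0: "e = (\<lambda>_. 0)" by auto
    have "dom_coeff e = 0" by (simp add: dom_coeff_def e0)
    with e0 show ?thesis using that[of 0] t mu nu dl r by simp
  next
    case False
    then have *: "mu ^ (k - 1) / 4 \<le> t" using large M by (simp add: t_def)
    have "C \<le> x * t" if "C \<le> x * (mu ^ (k - 1) / 4)" "0 \<le> x" for x
      using that mult_left_mono[OF *, of x] by linarith
    then have "C \<le> (lam - mu) * t" "C \<le> (nu - lam) * t" "C \<le> dl * (mu - r) * t"
      using k_large mu nu dl by auto
    moreover have "\<bar>dom_coeff e\<bar> \<le> C \<and> (\<forall>n. \<bar>e n - dom_coeff e * lam ^ n\<bar> \<le> C * r ^ n)"
      by (rule C[OF ke]) (use close in \<open>auto simp: e_def\<close>)
    ultimately show ?thesis using that[of C] C_pos by auto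
  qed
  have the': "dom_coeff b' = lam * t + dom_coeff e" using the by (simp add: t_def)
  have lo: "mu * t \<le> dom_coeff b'" and up: "dom_coeff b' \<le> nu * t"
    using E(2,4,5) by (auto simp: the' algebra_simps abs_le_iff)
  show "mu * dom_coeff b / M \<le> dom_coeff b'" "dom_coeff b' \<le> nu * dom_coeff b / M" using lo up by (simp_all add: t_def)
  have "\<bar>b' n - dom_coeff b' * lam ^ n\<bar> \<le> dl * dom_coeff b' * r ^ n" for n
  proof -
    have "b' n - dom_coeff b' * lam ^ n = (b (n + 1) - dom_coeff b * lam ^ (n + 1)) / M + (e n - dom_coeff e * lam ^ n)"
      by (simp add: e_def the' t_def algebra_simps diff_divide_distrib)
    also have "\<bar>\<dots>\<bar> \<le> \<bar>b (n + 1) - dom_coeff b * lam ^ (n + 1)\<bar> / M + \<bar>e n - dom_coeff e * lam ^ n\<bar>"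
      by (rule order_trans[OF abs_triangle_ineq]) simp
    also have "\<dots> \<le> dl * dom_coeff b * r ^ (n + 1) / M + E * r ^ n"
      by (intro add_mono divide_right_mono cone_bound[OF b] E(3)) simp
    also have "\<dots> = (dl * r * t + E) * r ^ n"
      by (simp add: t_def algebra_simps)
    also have "\<dots> \<le> (dl * dom_coeff b') * r ^ n"
    proof (intro mult_right_mono)
      have "dl * r * t + E \<le> dl * (mu * t)" using E(6) by (simp add: algebra_simps)
      also have "\<dots> \<le> dl * dom_coeff b'" using lo dl by simp
      finally show "dl * r * t + E \<le> dl * dom_coeff b'" .
    qed (use r in simp)
    finally show ?thesis .
  qed
  moreover have "0 < dom_coeff b'" using lo mult_pos_pos[of mu t] t mu by linarith
  ultimately show "cone dl b'" using b' by (simp add: cone_def)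
qed

definition incr :: "(nat \<Rightarrow> int) \<Rightarrow> nat \<Rightarrow> int" where
  "incr a n = a (n + k) - a n"

definition weight :: "(nat \<Rightarrow> int) \<Rightarrow> real" where
  "weight a = dom_coeff (\<lambda>n. real_of_int (incr a n))"

text \<open>The lower end of the last condition keeps \<open>weight\<close> bounded through \<open>a 0 = 1\<close>; the upper end
  at \<open>n = 1\<close> makes \<open>weight a / a 1\<close> large whenever there is anything to round. The rates
  \<open>mu < lam < nu\<close> leave room for the rounding error of the weight.\<close>

definition good :: "(nat \<Rightarrow> int) \<Rightarrow> bool" where
  "good a \<longleftrightarrow> (\<forall>n. rec_op p (incr a) n = 0) \<and> a 0 = 1 \<and> (\<forall>n<k. a n \<le> a (Suc n)) \<and>
     cone dl (\<lambda>n. real_of_int (incr a n)) \<and>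
     (\<forall>n\<le>k. a n - 1 \<le> 2 * weight a / mu ^ (k - n) \<and> weight a / 2 / nu ^ (k - n) \<le> a n + 1)"

text \<open>At index 0 both powers are 1, so the weight measures \<open>a k - a 0\<close> up to the
  factors \<open>1 - dl\<close> and \<open>1 + dl\<close>. Positivity follows from
  \<open>dl < 1\<close> and \<open>r < lam\<close>.\<close>

lemma incr_bounds:
  assumes "cone dl (\<lambda>n. real_of_int (incr a n))"
  shows "(1 - dl) * weight a \<le> incr a 0" "incr a 0 \<le> (1 + dl) * weight a" "0 < weight a" "0 < incr a n"
proof -
  show w: "0 < weight a" using cone_pos[OF assms] by (simp add: weight_def)
  have *: "\<bar>incr a n - weight a * lam ^ n\<bar> \<le> dl * weight a * r ^ n" for n
    using cone_bound[OF assms] by (simp add: weight_def)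
  show "(1 - dl) * weight a \<le> incr a 0" "incr a 0 \<le> (1 + dl) * weight a"
    using *[of 0] by (simp_all add: abs_le_iff algebra_simps)
  have "dl * weight a * r ^ n < 1 * weight a * lam ^ n"
    using dl w r by (intro mult_less_le_imp_less power_mono mult_strict_right_mono) auto
  then have "0 < real_of_int (incr a n)" using *[of n] by linarith
  then show "0 < incr a n" by simp
qed

section \<open>Splitting a shifted sequence into children\<close>

text \<open>Only the \<open>degree p\<close> initial increments are rounded; the rest follow from
  the recurrence, so children are again killed by \<open>p\<close>.\<close>

definition child_incr :: "(nat \<Rightarrow> int) \<Rightarrow> nat \<Rightarrow> nat \<Rightarrow> int" where
  "child_incr a j = rec_seq p (\<lambda>i. (incr a (i + 1) + int j) div a 1)"

text \<open>The \<open>k\<close> free values are rounded, and the sum adds the increments along the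
  residue class of \<open>n\<close> modulo \<open>k\<close>.\<close>

definition child :: "(nat \<Rightarrow> int) \<Rightarrow> nat \<Rightarrow> nat \<Rightarrow> int" where
  "child a j n = (a (n mod k + 1) + int j) div a 1 + (\<Sum>i<n div k. child_incr a j (n mod k + i * k))"

lemma child_low: "n < k \<Longrightarrow> child a j n = (a (n + 1) + int j) div a 1"
  by (simp add: child_def)

lemma incr_child: "incr (child a j) n = child_incr a j n"
proof -
  have "(n + k) div k = Suc (n div k)" using k_pos by simp
  then show ?thesis by (simp add: incr_def child_def)
qed

text \<open>Hermite's identity settles the initial increments and the free values. Both sides obey
  the same recurrences, which propagate the equality.\<close>

lemma sum_child:
  assumes "good a"
  shows "(\<Sum>j<nat (a 1). child a j n) = a (n + 1)"
proof -
  have "a 0 \<le> a 1" "a 0 = 1" using assms k_pos by (auto simp: good_def)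
  define M where "M = nat (a 1)"
  have M: "a 1 = int M" "M > 0" using \<open>a 0 \<le> a 1\<close> \<open>a 0 = 1\<close> by (simp_all add: M_def)
  have inc: "(\<Sum>j<M. child_incr a j n) - incr a (n + 1) = 0" for n
  proof (rule rec_op_zero_unique[OF monic, where s = "\<lambda>n. (\<Sum>j<M. child_incr a j n) - incr a (n + 1)"])
    show "rec_op p (\<lambda>n. (\<Sum>j<M. child_incr a j n) - incr a (n + 1)) n = 0" for n
      using assms
      by (simp add: rec_op_seq_diff rec_op_seq_sum child_incr_def rec_op_rec_seq[OF monic] good_def
          rec_op_shift[of p "incr a" 1, simplified])
    show "i < degree p \<Longrightarrow> (\<Sum>j<M. child_incr a j i) - incr a (i + 1) = 0" for i
      by (simp add: child_incr_def rec_seq_init M(1)[simplified] sum_div_shift[OF M(2)])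
  qed
  have "(\<Sum>j<M. child a j n) = a (n + 1)"
  proof (induction n rule: less_induct)
    case (less n)
    show ?case
    proof (cases "n < k")
      case True
      then show ?thesis by (simp add: child_low M(1)[simplified] sum_div_shift[OF M(2)])
    next
      case False
      define m where "m = n - k"
      have m: "n = m + k" "m < n" using False k_pos by (auto simp: m_def)
      have "child a j n = child a j m + child_incr a j m" for j
        using incr_child[of a j m] by (simp add: incr_def m(1))
      then have "(\<Sum>j<M. child a j n) = a (m + 1) + incr a (m + 1)"
        using less[OF m(2)] inc[of m] by (simp add: sum.distrib)
      then show ?thesis by (simp add: incr_def m(1) add_ac)
    qed
  qed
  then show ?thesis by (simp add: M(1)[simplified])
qed

lemma div_close:
  assumes "j < M"
  shows "(real_of_int x + 1 - real M) / M \<le> real_of_int ((x + int j) div int M)"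
    "real_of_int ((x + int j) div int M) \<le> (real_of_int x + real M - 1) / M"
proof -
  have M: "int M > 0" using assms by simp
  have eq: "x + int j = int M * ((x + int j) div int M) + (x + int j) mod int M" by simp
  have "0 \<le> (x + int j) mod int M" "(x + int j) mod int M \<le> int M - 1" using M by simp_all
  then have *: "x + 1 - int M \<le> int M * ((x + int j) div int M)" "int M * ((x + int j) div int M) \<le> x + int M - 1"
    using eq assms by linarith+
  have "real_of_int (x + 1 - int M) \<le> real_of_int (int M * ((x + int j) div int M))"
    "real_of_int (int M * ((x + int j) div int M)) \<le> real_of_int (x + int M - 1)"
    using * by (simp_all only: of_int_le_iff)
  then show "(real_of_int x + 1 - real M) / M \<le> real_of_int ((x + int j) div int M)"
    "real_of_int ((x + int j) div int M) \<le> (real_of_int x + real M - 1) / M"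
    using assms by (simp_all add: field_simps)
qed

text \<open>Rounding is harmless for both growth bounds: from \<open>(x + j) div M \<le> (x + M - 1) / M\<close> the
  quantity \<open>a n - 1\<close> is at most divided by \<open>M\<close>, and symmetrically for \<open>a n + 1\<close>.\<close>

lemma good_child:
  assumes a: "good a" and j: "j < nat (a 1)"
  shows "good (child a j)"
proof -
  have a0: "a 0 = 1" and mono: "\<And>n. n < k \<Longrightarrow> a n \<le> a (Suc n)"
    and ca: "cone dl (\<lambda>n. real_of_int (incr a n))"
    and up: "\<And>n. n \<le> k \<Longrightarrow> a n - 1 \<le> 2 * weight a / mu ^ (k - n)"
    and lo: "\<And>n. n \<le> k \<Longrightarrow> weight a / 2 / nu ^ (k - n) \<le> a n + 1"
    using a by (auto simp: good_def)
  note w = incr_bounds[OF ca]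
  define M where "M = nat (a 1)"
  have jM: "j < M" using j by (simp add: M_def)
  have aM: "a 1 = int M" and M1: "M \<ge> 1" using j by (auto simp: M_def)
  let ?c = "child a j"
  have kc: "rec_op p (incr ?c) n = 0" for n
    by (simp add: incr_child[abs_def] child_incr_def rec_op_rec_seq[OF monic])
  \<comment> \<open>The upper growth bound at \<open>n = 1\<close>, combined with
    \<open>M - 1 \<ge> M / 2\<close>.\<close>
  have large: "mu ^ (k - 1) / 4 \<le> weight a / M" if "M \<ge> 2"
  proof -
    have "real M - 1 \<le> 2 * weight a / mu ^ (k - 1)" using up[of 1] k_pos aM by simp
    then have "(real M - 1) * mu ^ (k - 1) \<le> 2 * weight a" using mu by (simp add: field_simps)
    moreover have "real M / 2 * mu ^ (k - 1) \<le> (real M - 1) * mu ^ (k - 1)"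
      using that mu by (intro mult_right_mono) auto
    moreover have "mu ^ (k - 1) / 4 * real M = (real M / 2 * mu ^ (k - 1)) / 2" by simp
    ultimately have "mu ^ (k - 1) / 4 * real M \<le> weight a" by linarith
    then show ?thesis using M1 by (simp add: pos_le_divide_eq)
  qed
  have wc: "weight ?c = dom_coeff (\<lambda>n. real_of_int (child_incr a j n))"
    by (simp add: weight_def incr_child)
  have kci: "killed (\<lambda>n. real_of_int (child_incr a j n))"
    using killed_of_int[of "incr ?c"] kc by (simp add: incr_child)
  have close: "\<bar>real_of_int (child_incr a j i) - real_of_int (incr a (i + 1)) / real M\<bar> \<le> 1"
    if "i < degree p" for i
    using div_close[OF jM, of "incr a (i + 1)"] that M1
    by (auto simp: child_incr_def rec_seq_init aM[simplified] field_simps abs_le_iff)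
  have exact: "real_of_int (child_incr a j i) = real_of_int (incr a (i + 1))"
    if "M = 1" "i < degree p" for i
    using that jM by (simp add: child_incr_def rec_seq_init aM[simplified])
  note divide = cone_divide[OF ca M1 kci close exact large[unfolded weight_def]]
  have cc: "cone dl (\<lambda>n. real_of_int (child_incr a j n))" by (rule divide(1))
  have wlo: "mu * weight a / M \<le> weight ?c" unfolding wc unfolding weight_def by (rule divide(2))
  have wup: "weight ?c \<le> nu * weight a / M" unfolding wc unfolding weight_def by (rule divide(3))
  have cc': "cone dl (\<lambda>n. real_of_int (incr ?c n))" using cc by (simp add: incr_child)
  note w' = incr_bounds[OF cc']
  \<comment> \<open>Dividing by \<open>a 1\<close> itself makes the first value
    \<open>(M + j) div M\<close>, which is 1 since \<open>j < M\<close>.\<close>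
  have c0: "?c 0 = 1" using jM k_pos by (simp add: child_low aM[simplified])
  have ck: "?c k = 1 + incr ?c 0" using c0 by (simp add: incr_def)
  have ak: "a k = 1 + incr a 0" using a0 by (simp add: incr_def)
  have hi: "?c n - 1 \<le> (a (n + 1) - 1) / M" if "n < k" for n
    using div_close(2)[OF jM, of "a (n + 1)"] that M1 by (simp add: child_low aM[simplified] field_simps)
  have lw: "(a (n + 1) + 1) / M \<le> ?c n + 1" if "n < k" for n
    using div_close(1)[OF jM, of "a (n + 1)"] that M1 by (simp add: child_low aM[simplified] field_simps)
  have "?c n \<le> ?c (Suc n)" if n: "n < k" for n
  proof (cases "Suc n < k")
    case True
    then show ?thesis using n mono[of "Suc n"] M1 by (simp add: child_low aM[simplified] zdiv_mono1)
  next
    \<comment> \<open>At \<open>n = k - 1\<close> the free value minus 1 is at most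
      \<open>(1 + dl) * weight a / M\<close>, and the first increment of the child is at least
      \<open>(1 - dl) * mu * weight a / M\<close>.\<close>
    case False
    then have nk: "Suc n = k" using n by simp
    have "?c n - 1 \<le> incr a 0 / M" using hi[OF n] nk ak by simp
    also have "\<dots> \<le> (1 + dl) * weight a / M" using w(2) by (simp add: divide_right_mono)
    also have "\<dots> \<le> (1 - dl) * mu * weight a / M"
      using dl(3) w(3) by (intro divide_right_mono mult_right_mono) auto
    also have "\<dots> = (1 - dl) * (mu * weight a / M)" by simp
    also have "\<dots> \<le> (1 - dl) * weight ?c" using wlo dl by (intro mult_left_mono) auto
    also have "\<dots> \<le> incr ?c 0" by (rule w'(1))
    finally show ?thesis using ck nk by simp
  qed
  moreover have "?c n - 1 \<le> 2 * weight ?c / mu ^ (k - n)" if "n \<le> k" for n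
  proof (cases "n = k")
    case True
    have "incr ?c 0 \<le> (1 + dl) * weight ?c" by (rule w'(2))
    also have "\<dots> \<le> 2 * weight ?c" using dl w'(3) by (intro mult_right_mono) auto
    finally show ?thesis using True ck by simp
  next
    case False
    then have n: "n < k" using that by simp
    have "?c n - 1 \<le> (a (n + 1) - 1) / M" by (rule hi[OF n])
    also have "\<dots> \<le> (2 * weight a / mu ^ (k - (n + 1))) / M"
      using up[of "n + 1"] n by (intro divide_right_mono) auto
    also have "\<dots> = 2 * (mu * weight a / M) / mu ^ (k - n)"
    proof -
      have "mu ^ (k - n) = mu * mu ^ (k - (n + 1))" using n by (metis Suc_diff_Suc Suc_eq_plus1 power_Suc)
      then show ?thesis using mu by (simp add: field_simps)
    qed
    also have "\<dots> \<le> 2 * weight ?c / mu ^ (k - n)"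
      using wlo mu by (intro divide_right_mono mult_left_mono) auto
    finally show ?thesis .
  qed
  moreover have "weight ?c / 2 / nu ^ (k - n) \<le> ?c n + 1" if "n \<le> k" for n
  proof (cases "n = k")
    case True
    have "1 / 2 * weight ?c \<le> (1 - dl) * weight ?c" using dl w'(3) by (intro mult_right_mono) auto
    also have "\<dots> \<le> incr ?c 0" by (rule w'(1))
    finally show ?thesis using True ck by simp
  next
    case False
    then have n: "n < k" using that by simp
    have nu0: "nu > 0" using nu lam by simp
    have "weight ?c / 2 / nu ^ (k - n) \<le> (nu * weight a / M) / 2 / nu ^ (k - n)"
      using wup nu0 by (intro divide_right_mono) auto
    also have "\<dots> = (weight a / 2 / nu ^ (k - (n + 1))) / M"
    proof -
      have "nu ^ (k - n) = nu * nu ^ (k - (n + 1))" using n by (metis Suc_diff_Suc Suc_eq_plus1 power_Suc)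
      then show ?thesis using nu0 by (simp add: field_simps)
    qed
    also have "\<dots> \<le> (a (n + 1) + 1) / M"
      using lo[of "n + 1"] n by (intro divide_right_mono) auto
    also have "\<dots> \<le> ?c n + 1" by (rule lw[OF n])
    finally show ?thesis .
  qed
  ultimately show ?thesis using kc c0 cc' unfolding good_def by auto
qed

text \<open>The lower growth bound at \<open>n = 0\<close>, with \<open>a 0 = 1\<close>, gives
  weight at most \<open>4 * nu ^ k\<close>. This bounds the \<open>k\<close> free values and the
  \<open>degree p\<close> initial increments, which determine the sequence.\<close>

lemma finite_good: "finite {a. good a}"
proof -
  define D where "D = degree p"
  define X where "X = \<lceil>1 + 8 * nu ^ k\<rceil> + \<lceil>4 * nu ^ k * (2 * lam ^ D)\<rceil>"
  define code where "code a = (map a [0..<k], map (incr a) [0..<D])" for a :: "nat \<Rightarrow> int"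
  let ?L = "\<lambda>n. {xs. set xs \<subseteq> {-X..X} \<and> length xs = n}"
  have nu1: "nu \<ge> 1" using nu lam by simp
  have "code a \<in> ?L k \<times> ?L D" if a: "good a" for a
  proof -
    have c: "cone dl (\<lambda>n. real_of_int (incr a n))" using a by (simp add: good_def)
    note w = incr_bounds[OF c]
    have "weight a / 2 / nu ^ k \<le> a 0 + 1" "a 0 = 1" using a by (auto simp: good_def)
    then have wb: "weight a \<le> 4 * nu ^ k" using nu1 by (simp add: field_simps)
    have X: "1 + 8 * nu ^ k \<le> X" "4 * nu ^ k * (2 * lam ^ D) \<le> X"
    proof -
      have "0 \<le> 1 + 8 * nu ^ k" "0 \<le> 4 * nu ^ k * (2 * lam ^ D)" using nu1 lam by simp_all
      then show "1 + 8 * nu ^ k \<le> X" "4 * nu ^ k * (2 * lam ^ D) \<le> X"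
        unfolding X_def by linarith+
    qed
    have "a n \<in> {-X..X}" if n: "n < k" for n
    proof -
      have "1 \<le> a n" using n
      proof (induction n)
        case (Suc n)
        then have "1 \<le> a n" "a n \<le> a (Suc n)" using a by (auto simp: good_def)
        then show ?case by simp
      qed (use a in \<open>simp add: good_def\<close>)
      moreover have "a n \<le> X"
      proof -
        have "a n - 1 \<le> 2 * weight a / mu ^ (k - n)" using a n by (simp add: good_def)
        also have "\<dots> \<le> 2 * weight a / 1"
          using mu w by (intro divide_left_mono) auto
        finally have "real_of_int (a n) \<le> X" using wb X by linarith
        then show ?thesis by simp
      qed
      ultimately show ?thesis by simp
    qed
    moreover have "incr a n \<in> {-X..X}" if n: "n < D" for n
    proof -
      have "incr a n \<le> weight a * lam ^ n + dl * weight a * r ^ n"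
        using cone_bound[OF c, of n] by (simp add: weight_def abs_le_iff)
      also have "\<dots> \<le> weight a * lam ^ D + 1 * weight a * lam ^ D"
      proof (intro add_mono mult_mono)
        show "lam ^ n \<le> lam ^ D" using lam n by (intro power_increasing) auto
        moreover have "r ^ n \<le> lam ^ n" using r by (intro power_mono) auto
        ultimately show "r ^ n \<le> lam ^ D" by linarith
      qed (use w dl r lam in auto)
      also have "\<dots> = weight a * (2 * lam ^ D)" by simp
      also have "\<dots> \<le> 4 * nu ^ k * (2 * lam ^ D)" using wb lam by (intro mult_right_mono) auto
      finally have "real_of_int (incr a n) \<le> X" using X by linarith
      then show ?thesis using w(4)[of n] by simp
    qed
    ultimately show ?thesis by (auto simp: code_def)
  qed
  then have sub: "code ` {a. good a} \<subseteq> ?L k \<times> ?L D" by blast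
  have fin: "finite (?L k \<times> ?L D)" by (intro finite_cartesian_product finite_lists_length_eq) auto
  have inj: "inj_on code {a. good a}"
  proof (rule inj_onI)
    fix a a' assume a: "a \<in> {a. good a}" "a' \<in> {a. good a}" and eq: "code a = code a'"
    have inc: "incr a n - incr a' n = 0" for n
    proof (rule rec_op_zero_unique[OF monic, where s = "\<lambda>n. incr a n - incr a' n"])
      show "rec_op p (\<lambda>n. incr a n - incr a' n) n = 0" for n
        using a by (simp add: rec_op_seq_diff good_def)
      show "i < degree p \<Longrightarrow> incr a i - incr a' i = 0" for i
        using eq by (simp add: code_def D_def)
    qed
    have "a n = a' n" for n
    proof (induction n rule: less_induct)
      case (less n)
      show ?case
      proof (cases "n < k")
        case True
        then show ?thesis using eq by (simp add: code_def)
      next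
        case False
        then have "n = n - k + k" "n - k < n" using k_pos by auto
        then show ?thesis using less[of "n - k"] inc[of "n - k"] by (simp add: incr_def)
      qed
    qed
    then show "a = a'" by auto
  qed
  show ?thesis by (rule inj_on_finite[OF inj sub fin])
qed

text \<open>The free values interpolate geometrically with ratio \<open>mu\<close> up to half the
  weight; since \<open>mu < nu\<close> this satisfies both growth bounds. The smallness hypothesis
  puts \<open>g 0\<close> below 1, so that \<open>a 0 = 1\<close>.\<close>

lemma good_exists:
  assumes b: "cone dl (\<lambda>n. real_of_int (b n))" and kb: "\<And>n. rec_op p b n = 0"
    and small: "dom_coeff (\<lambda>n. real_of_int (b n)) / 2 < mu ^ k"
  shows "\<exists>a. good a"
proof -
  define W where "W = dom_coeff (\<lambda>n. real_of_int (b n))"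
  define g where "g n = W / 2 / mu ^ (k - n)" for n
  define a where "a n = 1 + \<lfloor>g (n mod k)\<rfloor> + (\<Sum>i<n div k. b (n mod k + i * k))" for n
  have low: "a n = 1 + \<lfloor>g n\<rfloor>" if "n < k" for n using that by (simp add: a_def)
  have inc: "incr a = b"
  proof
    fix n
    have "(n + k) div k = Suc (n div k)" using k_pos by simp
    then show "incr a n = b n" by (simp add: incr_def a_def)
  qed
  have c: "cone dl (\<lambda>n. real_of_int (incr a n))" using b by (simp add: inc)
  have wa: "weight a = W" by (simp add: weight_def W_def inc)
  note w = incr_bounds[OF c, unfolded wa inc]
  have a0: "a 0 = 1"
    using k_pos small w(3) mu by (simp add: low g_def W_def floor_eq_iff)
  have ak: "a k = 1 + b 0" using a0 inc by (metis add.commute add_0 diff_add_cancel incr_def)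
  have half: "W / 2 \<le> b 0"
  proof -
    have "1 / 2 * W \<le> (1 - dl) * W" using dl w(3) by (intro mult_right_mono) auto
    then show ?thesis using w(1) by linarith
  qed
  have gW: "0 \<le> g n" "g n \<le> W / 2" for n
  proof -
    show "0 \<le> g n" using w(3) mu by (simp add: g_def)
    have "W / 2 / mu ^ (k - n) \<le> W / 2 / 1" using w(3) mu by (intro divide_left_mono) auto
    then show "g n \<le> W / 2" by (simp add: g_def)
  qed
  have "a n \<le> a (Suc n)" if n: "n < k" for n
  proof (cases "Suc n < k")
    case True
    have "g n \<le> g (Suc n)"
      unfolding g_def using w(3) mu by (intro divide_left_mono power_increasing) auto
    then show ?thesis using True n by (simp add: low floor_mono)
  next
    case False
    then have "Suc n = k" using n by simp
    moreover have "\<lfloor>g n\<rfloor> \<le> b 0" using gW(2)[of n] half by linarith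
    ultimately show ?thesis using ak low[OF n] by simp
  qed
  moreover have "a n - 1 \<le> 2 * W / mu ^ (k - n) \<and> W / 2 / nu ^ (k - n) \<le> a n + 1" if "n \<le> k" for n
  proof (cases "n = k")
    case True
    have "b 0 \<le> (1 + dl) * W" by (rule w(2))
    also have "\<dots> \<le> 2 * W" using dl w(3) by (intro mult_right_mono) auto
    finally show ?thesis using True ak half by simp
  next
    case False
    then have n: "n < k" using that by simp
    have "g n \<le> 2 * W / mu ^ (k - n)"
      unfolding g_def using w(3) mu by (intro divide_right_mono) auto
    moreover have "W / 2 / nu ^ (k - n) \<le> g n"
      unfolding g_def using w(3) mu nu by (intro divide_left_mono power_mono) auto
    ultimately show ?thesis using low[OF n] by (simp; linarith)
  qed
  ultimately show ?thesis using a0 c kb by (intro exI[of _ a]) (auto simp: good_def inc wa)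
qed

end

section \<open>Positive endomorphisms\<close>

lemma reduce_positive:
  assumes "\<And>x. x \<in> set w \<Longrightarrow> \<not> snd x"
  shows "reduce w = w"
  using assms
proof (induction w)
  case (Cons x w)
  then have "reduce (x # w) = cancel_step x w" by (simp add: reduce_def)
  also have "\<dots> = x # w"
  proof (cases w)
    case w: (Cons y ys)
    have "\<not> snd y" "\<not> snd x" using Cons.prems[of y] Cons.prems[of x] w by auto
    then have "y \<noteq> inv_letter x" by (auto simp: inv_letter_def)
    then show ?thesis using w by simp
  qed simp
  finally show ?case .
qed (simp add: reduce_def)

lemma endo_apply_positive:
  assumes "\<And>x. x \<in> set w \<Longrightarrow> \<not> snd x \<and> (\<forall>y\<in>set (f (fst x)). \<not> snd y)"
  shows "endo_apply f w = concat (map (\<lambda>x. f (fst x)) w)"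
proof -
  have eq: "map (\<lambda>x. if snd x then inv_word (f (fst x)) else f (fst x)) w = map (\<lambda>x. f (fst x)) w"
    using assms by (intro map_cong) auto
  have pos: "\<not> snd y" if y: "y \<in> set (concat (map (\<lambda>x. f (fst x)) w))" for y
  proof -
    obtain x where "x \<in> set w" "y \<in> set (f (fst x))"
      using y unfolding set_concat set_map by blast
    then show ?thesis using assms by blast
  qed
  show ?thesis unfolding endo_apply_def eq by (rule reduce_positive[OF pos])
qed

lemma sum_list_concat_map:
  fixes g :: "'b \<Rightarrow> 'c::comm_monoid_add"
  shows "(\<Sum>y\<leftarrow>concat (map h xs). g y) = (\<Sum>x\<leftarrow>xs. \<Sum>y\<leftarrow>h x. g y)"
  by (induction xs) simp_all

text \<open>Stated for all positive words, since the induction applies \<open>f\<close> to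
  \<open>w\<close> first and then needs the claim for the image. Lengths add because nothing
  cancels.\<close>

lemma positive_endo_length:
  fixes L :: "nat \<Rightarrow> nat \<Rightarrow> int"
  assumes f: "\<And>i x. i < m \<Longrightarrow> x \<in> set (f i) \<Longrightarrow> fst x < m \<and> \<not> snd x"
    and L0: "\<And>i. i < m \<Longrightarrow> L i 0 = 1"
    and L: "\<And>i n. i < m \<Longrightarrow> L i (Suc n) = (\<Sum>x\<leftarrow>f i. L (fst x) n)"
    and w: "\<And>x. x \<in> set w \<Longrightarrow> fst x < m \<and> \<not> snd x"
  shows "int (word_length ((endo_apply f ^^ n) w)) = (\<Sum>x\<leftarrow>w. L (fst x) n)"
  using w
proof (induction n arbitrary: w)
  case 0
  have "(\<Sum>x\<leftarrow>w. L (fst x) 0) = (\<Sum>x\<leftarrow>w. 1)"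
    by (intro arg_cong[of _ _ sum_list] map_cong refl) (use 0 L0 in auto)
  moreover have "reduce w = w" using 0 by (intro reduce_positive) auto
  ultimately show ?case by (simp add: word_length_def sum_list_triv)
next
  case (Suc n)
  have eq: "endo_apply f w = concat (map (\<lambda>x. f (fst x)) w)"
    using Suc.prems f by (intro endo_apply_positive) blast
  have "int (word_length ((endo_apply f ^^ n) (endo_apply f w)))
      = (\<Sum>x\<leftarrow>concat (map (\<lambda>x. f (fst x)) w). L (fst x) n)"
    unfolding eq
  proof (rule Suc.IH)
    fix y assume "y \<in> set (concat (map (\<lambda>x. f (fst x)) w))"
    then obtain x where "x \<in> set w" "y \<in> set (f (fst x))"
      unfolding set_concat set_map by blast
    then show "fst y < m \<and> \<not> snd y" using Suc.prems f by blast
  qed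
  also have "\<dots> = (\<Sum>x\<leftarrow>w. \<Sum>y\<leftarrow>f (fst x). L (fst y) n)"
    by (rule sum_list_concat_map)
  also have "\<dots> = (\<Sum>x\<leftarrow>w. L (fst x) (Suc n))"
    by (intro arg_cong[of _ _ sum_list] map_cong refl) (use Suc.prems L in auto)
  finally show ?case by (simp add: funpow_swap1)
qed

text \<open>Generators number the members of \<open>S\<close>, and the image of a generator spells
  the chosen summands of its shift.\<close>

lemma endo_of_family:
  fixes S :: "(nat \<Rightarrow> int) set"
  assumes "finite S" "S \<noteq> {}" and start: "\<forall>a\<in>S. a 0 = 1"
    and split: "\<forall>a\<in>S. \<exists>as. set as \<subseteq> S \<and> (\<forall>n. a (Suc n) = (\<Sum>x\<leftarrow>as. x n))"
  obtains m and f :: "nat \<Rightarrow> letter list" where "m \<ge> 1"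
    "\<And>i. i < m \<Longrightarrow> word_on m (f i) \<and> reduce (f i) = f i"
    "\<And>i. i < m \<Longrightarrow> \<exists>a\<in>S. \<forall>n. int (word_length ((endo_apply f ^^ n) [(i, False)])) = a n"
proof -
  define m where "m = card S"
  obtain h where h: "bij_betw h {0..<m} S"
    using ex_bij_betw_nat_finite[OF assms(1)] by (auto simp: m_def)
  obtain as where as: "\<And>a. a \<in> S \<Longrightarrow> set (as a) \<subseteq> S"
    "\<And>a n. a \<in> S \<Longrightarrow> a (Suc n) = (\<Sum>x\<leftarrow>as a. x n)"
    using split by metis
  define idx where "idx = inv_into {0..<m} h"
  have idx: "idx a < m" "h (idx a) = a" if "a \<in> S" for a
    using that h bij_betw_inv_into_right[OF h that] bij_betwE[OF bij_betw_inv_into[OF h]]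
    by (auto simp: idx_def)
  have hS: "h i \<in> S" if "i < m" for i using that bij_betwE[OF h] by auto
  define f :: "nat \<Rightarrow> letter list" where "f i = map (\<lambda>a. (idx a, False)) (as (h i))" for i
  have f: "fst x < m \<and> \<not> snd x" if "i < m" "x \<in> set (f i)" for i x
    using that(2) subsetD[OF as(1)[OF hS[OF that(1)]]] idx(1) by (auto simp: f_def)
  have L: "h i (Suc n) = (\<Sum>x\<leftarrow>f i. h (fst x) n)" if "i < m" for i n
  proof -
    have "(\<Sum>x\<leftarrow>f i. h (fst x) n) = (\<Sum>a\<leftarrow>as (h i). a n)"
      unfolding f_def map_map comp_def
      by (intro arg_cong[of _ _ sum_list] map_cong refl) (use as(1)[OF hS[OF that]] idx(2) in auto)
    then show ?thesis using as(2)[OF hS[OF that]] by simp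
  qed
  have "int (word_length ((endo_apply f ^^ n) [(i, False)])) = h i n" if "i < m" for i n
    using positive_endo_length[of m f h "[(i, False)]" n, OF f start[rule_format, OF hS] L] that by simp
  moreover have "m \<ge> 1" using assms(1,2) by (simp add: m_def Suc_le_eq card_gt_0_iff)
  moreover have "word_on m (f i) \<and> reduce (f i) = f i" if "i < m" for i
    using f[OF that] reduce_positive[of "f i"] by (auto simp: word_on_def)
  ultimately show ?thesis using that hS by blast
qed

section \<open>Minimal polynomials and growth of exponential sums\<close>

lemma cyclotomic_1: "cyclotomic 1 = [:- 1, 1:]"
proof -
  have "{k. k < 1 \<and> coprime k (1::nat)} = {0}" by auto
  then show ?thesis by (simp add: cyclotomic_def)
qed

text \<open>Below a prime, coprime to it means nonzero, so only the root 1 drops out.\<close>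

lemma cyclotomic_prime:
  assumes k: "prime k"
  shows "cyclotomic k = (\<Prod>z\<in>{z. z ^ k = 1} - {1}. [:- z, 1:])"
proof -
  let ?e = "\<lambda>j. cis (2 * pi * real j / real k)"
  have k0: "k > 0" using k by (simp add: prime_gt_0_nat)
  have "coprime j k \<longleftrightarrow> j \<noteq> 0" if "j < k" for j
  proof
    assume "j \<noteq> 0"
    then have "\<not> k dvd j" using that nat_dvd_not_less by blast
    then have "algebraic_semidom_class.coprime k j" by (rule prime_imp_coprime[OF k])
    then show "coprime j k" by (simp add: algebraic_semidom_class.coprime_commute)
  next
    assume "coprime j k"
    then show "j \<noteq> 0" using prime_gt_1_nat[OF k] by (cases "j = 0") simp_all
  qed
  then have idx: "{j. j < k \<and> coprime j k} = {..<k} - {0}" by auto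
  have bij: "bij_betw ?e {..<k} {z. z ^ k = 1}" by (rule bij_betw_roots_unity[OF k0])
  then have "bij_betw ?e ({..<k} - {0}) ({z. z ^ k = 1} - ?e ` {0})"
    by (intro bij_betw_DiffI) (use k0 in \<open>auto simp: bij_betw_def\<close>)
  then have "bij_betw ?e ({..<k} - {0}) ({z. z ^ k = 1} - {1})" by simp
  then show ?thesis
    unfolding cyclotomic_def idx by (rule prod.reindex_bij_betw)
qed

lemma mahler_measure_poly_prod:
  assumes "finite I"
  shows "mahler_measure_poly (\<Prod>i\<in>I. [:- g i, 1:]) = (\<Prod>i\<in>I. max 1 (cmod (g i)))"
  using assms
proof (induction I rule: finite_induct)
  case empty
  show ?case using mahler_measure_constant[of 1] by (simp add: one_pCons[symmetric])
next
  case (insert i I)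
  moreover have "mahler_measure_poly [:- g i, 1:] = max 1 (cmod (g i))" by simp
  ultimately show ?case
    unfolding prod.insert[OF insert.hyps] measure_eq_prod by (simp only:)
qed

lemma mahler_measure_cyclotomic: "mahler_measure_poly (cyclotomic n) = 1"
  unfolding cyclotomic_def by (subst mahler_measure_poly_prod) simp_all

context exp_sum_seq
begin

text \<open>Starting the sequence at index 1 multiplies each coefficient by its base
  \<open>z\<close>; this is why 0 must later be excluded from \<open>Z\<close>.\<close>

lemma annihilates_iff: "annihilates q (\<lambda>n. a (Suc n))
    \<longleftrightarrow> (\<forall>n. (\<Sum>z\<in>Z. (\<alpha> z * z * poly q z) * z ^ n) = 0)"
proof -
  have "(\<Sum>j\<le>degree q. coeff q j * complex_of_real (a (Suc (n + j))))
      = (\<Sum>z\<in>Z. (\<alpha> z * z * poly q z) * z ^ n)" for n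
  proof -
    have "(\<lambda>n. complex_of_real (a (Suc n))) = (\<lambda>n. \<Sum>z\<in>Z. (\<alpha> z * z) * z ^ n)"
      by (simp add: expansion mult.assoc)
    then have "rec_op q (\<lambda>n. complex_of_real (a (Suc n))) n = (\<Sum>z\<in>Z. (\<alpha> z * z * poly q z) * z ^ n)"
      by (simp only: rec_op_exp_sum)
    then show ?thesis by (simp add: rec_op_def)
  qed
  then show ?thesis by (simp add: annihilates_def)
qed

text \<open>By uniqueness of exponential expansions every annihilator vanishes on all of
  \<open>Z\<close>, so its degree is at least \<open>card Z\<close>.\<close>

lemma minimal_poly:
  assumes "0 \<notin> Z"
  shows "minimal_poly_seq (\<lambda>n. a (Suc n)) (\<Prod>z\<in>Z. [:- z, 1:])"
proof -
  let ?Q = "\<Prod>z\<in>Z. [:- z, 1:]"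
  have deg: "degree ?Q = card Z" by (subst degree_prod_eq_sum_degree) auto
  have "lead_coeff ?Q = 1" by (simp add: lead_coeff_prod)
  moreover have "annihilates ?Q (\<lambda>n. a (Suc n))"
    unfolding annihilates_iff using fin by (auto simp: poly_prod intro!: sum.neutral)
  moreover have "degree ?Q \<le> degree r"
    if r: "lead_coeff r = 1" "annihilates r (\<lambda>n. a (Suc n))" for r
  proof -
    have r0: "r \<noteq> 0" using r(1) by auto
    have "poly r z = 0" if "z \<in> Z" for z
      using exp_sum_unique[OF fin that, of "\<lambda>z. \<alpha> z * z * poly r z"] r(2) coeff_nz[OF that] that assms
      by (auto simp: annihilates_iff)
    then have "card Z \<le> card {z. poly r z = 0}"
      using r0 by (intro card_mono poly_roots_finite) auto
    also have "\<dots> \<le> degree r" using r0 by (rule poly_roots_degree)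
    finally show ?thesis by (simp only: deg)
  qed
  ultimately show ?thesis by (simp add: minimal_poly_seq_def)
qed

text \<open>Cyclotomic factors have Mahler measure 1, so \<open>M\<close> equals the Mahler measure
  of \<open>p\<close>.\<close>

lemma growth_conclusion:
  assumes "0 \<notin> Z" and ns: "\<forall>d\<in>set ns. d \<ge> 1"
    and split: "(\<Prod>z\<in>Z. [:- z, 1:]) = map_poly of_int p * prod_list (map cyclotomic ns)"
  shows "linearly_recurrent (\<lambda>n. a (Suc n)) \<and>
    (\<exists>ns. (\<forall>d\<in>set ns. d \<ge> 1) \<and>
       minimal_poly_seq (\<lambda>n. a (Suc n)) (map_poly complex_of_int p * prod_list (map cyclotomic ns))) \<and>
    (\<forall>k. GR k a \<le> ereal (mahler_measure p)) \<and>
    (\<exists>k. GR k a = ereal (mahler_measure p))"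
proof -
  have "mahler_measure_poly (prod_list (map cyclotomic ns)) = 1"
  proof (induction ns)
    case Nil
    show ?case using mahler_measure_constant[of 1] by (simp add: one_pCons[symmetric])
  qed (simp add: measure_eq_prod mahler_measure_cyclotomic)
  then have "mahler_measure_poly (\<Prod>z\<in>Z. [:- z, 1:]) = mahler_measure p"
    unfolding split measure_eq_prod mahler_measure_def by (simp only: mult_1_right)
  then have M: "mahler_measure p = M"
    unfolding M_def mahler_measure_poly_prod[OF fin] by (rule sym)
  have "minimal_poly_seq (\<lambda>n. a (Suc n)) (map_poly complex_of_int p * prod_list (map cyclotomic ns))"
    using minimal_poly[OF assms(1)] by (simp only: split)
  then show ?thesis
    using ns GR_le GR_eq unfolding M linearly_recurrent_def minimal_poly_seq_def by blast
qed

end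

section \<open>Construction of the endomorphism\<close>

lemma finite_bound_between:
  fixes L :: real
  assumes "finite A" "0 < L" "\<And>x. x \<in> A \<Longrightarrow> x < L"
  shows "\<exists>r. 0 < r \<and> r < L \<and> (\<forall>x\<in>A. x < r)"
proof -
  \<comment> \<open>Inserting 0 keeps \<open>Max\<close> meaningful for empty \<open>A\<close> and
    makes the midpoint positive.\<close>
  define m where "m = Max (insert 0 A)"
  have m: "m < L" "0 \<le> m" "\<And>x. x \<in> A \<Longrightarrow> x \<le> m"
    using assms by (auto simp: m_def)
  have "x < (m + L) / 2" if "x \<in> A" for x using m(1) m(3)[OF that] by simp
  then show ?thesis using m(1,2) assms(2) by (intro exI[of _ "(m + L) / 2"]) auto
qed

lemma power_ge_eventually:
  fixes mu :: real
  assumes "1 < mu"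
  shows "\<exists>N. \<forall>n\<ge>N. X \<le> mu ^ n"
proof -
  obtain N where N: "X < mu ^ N" using real_arch_pow[OF assms] by blast
  have "X \<le> mu ^ n" if "n \<ge> N" for n
    using N power_increasing[OF that, of mu] assms by linarith
  then show ?thesis by blast
qed

context perron_factorization
begin

text \<open>The constants are fixed in order: \<open>mu\<close> and \<open>nu\<close> around
  \<open>lam\<close>, then \<open>dl\<close>, then the seed \<open>b\<close> with weight
  \<open>W\<close>. None of them depends on \<open>k\<close>, so a prime \<open>k\<close> can
  finally be taken large enough for all requirements.\<close>

lemma family_exists:
  shows "\<exists>k S. prime k \<and> finite S \<and> S \<noteq> {} \<and> (\<forall>a\<in>S. a 0 = 1 \<and>
     (\<forall>n. rec_op p (\<lambda>n. a (n + k) - a n) n = 0) \<and> a 0 < a k \<and>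
     (\<exists>as. set as \<subseteq> S \<and> (\<forall>n. a (Suc n) = (\<Sum>x\<leftarrow>as. x n :: int))))"
proof -
  obtain C where C: "0 < C" "\<And>e. killed e \<Longrightarrow> (\<forall>i<degree p. \<bar>e i\<bar> \<le> 1) \<Longrightarrow>
      \<bar>dom_coeff e\<bar> \<le> C \<and> (\<forall>n. \<bar>e n - dom_coeff e * lam ^ n\<bar> \<le> C * r ^ n)"
    using dominant_uniform by blast
  define mu where "mu = (max 1 r + lam) / 2"
  define nu where "nu = lam + 1"
  \<comment> \<open>The second bound is \<open>1 + dl \<le> (1 - dl) * mu\<close> solved for
    \<open>dl\<close>.\<close>
  define dl where "dl = min (1 / 2) ((mu - 1) / (mu + 1))"
  have mu: "1 < mu" "r < mu" "mu < lam" using r lam by (auto simp: mu_def)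
  have dl: "0 < dl" "dl \<le> 1 / 2"
    using mu min.cobounded1[of "1 / 2" "(mu - 1) / (mu + 1)"] by (simp_all only: dl_def) simp
  have "dl \<le> (mu - 1) / (mu + 1)" by (simp add: dl_def)
  then have "dl * (mu + 1) \<le> mu - 1" using mu by (simp add: pos_le_divide_eq)
  then have dl': "1 + dl \<le> (1 - dl) * mu" by (simp add: algebra_simps)
  obtain b where b: "cone dl (\<lambda>n. real_of_int (b n))" using cone_exists[OF dl(1)] by blast
  have kb: "rec_op p b n = 0" for n
  proof -
    have "rec_op (map_poly real_of_int p) (\<lambda>n. real_of_int (b n)) n = 0" using cone_killed[OF b] by blast
    then show ?thesis by (simp add: rec_op_of_int)
  qed
  define W where "W = dom_coeff (\<lambda>n. real_of_int (b n))"
  \<comment> \<open>The first three thresholds are the conditions \<open>k_large\<close>; the last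
    makes the seed admissible.\<close>
  define X where "X = Max {4 * C / (lam - mu), 4 * C / (nu - lam), 4 * C / (dl * (mu - r)), W}"
  have X: "4 * C / (lam - mu) \<le> X" "4 * C / (nu - lam) \<le> X" "4 * C / (dl * (mu - r)) \<le> X" "W \<le> X"
    by (auto simp: X_def)
  obtain N where N: "\<And>n. n \<ge> N \<Longrightarrow> X \<le> mu ^ n" using power_ge_eventually[OF mu(1)] by blast
  obtain k where k: "prime k" "Suc N < k" using bigger_prime by blast
  have k1: "X \<le> mu ^ (k - 1)" "X \<le> mu ^ k" using N k(2) by auto
  have large: "C \<le> y * (mu ^ (k - 1) / 4)" if "4 * C / y \<le> X" "y > 0" for y
  proof -
    have "4 * C / y \<le> mu ^ (k - 1)" using that(1) k1(1) by linarith
    then show ?thesis using that(2) by (simp add: pos_divide_le_eq mult.commute)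
  qed
  interpret pc: perron_constants p q lam r zs dl mu nu C k
  proof unfold_locales
    show "C \<le> (lam - mu) * (mu ^ (k - 1) / 4)" using large[OF X(1)] mu by simp
    show "C \<le> (nu - lam) * (mu ^ (k - 1) / 4)" using large[OF X(2)] by (simp add: nu_def)
    show "C \<le> dl * (mu - r) * (mu ^ (k - 1) / 4)" using large[OF X(3)] mu dl by simp
    show "0 < k" using k(2) by simp
    show "lam < nu" by (simp add: nu_def)
    show "killed e \<Longrightarrow> (\<forall>i<degree p. \<bar>e i\<bar> \<le> 1) \<Longrightarrow>
           \<bar>dom_coeff e\<bar> \<le> C \<and> (\<forall>n. \<bar>e n - dom_coeff e * lam ^ n\<bar> \<le> C * r ^ n)" for e
      by (rule C(2))
  qed (fact dl dl' mu C(1))+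
  have "0 < W" using cone_pos[OF b] by (simp add: W_def)
  then have "W / 2 < mu ^ k" using X(4) k1(2) by linarith
  then have "\<exists>a. pc.good a" using pc.good_exists[OF b kb] by (simp add: W_def)
  then have ne: "{a. pc.good a} \<noteq> {}" by blast
  have "a 0 = 1 \<and> (\<forall>n. rec_op p (\<lambda>n. a (n + k) - a n) n = 0) \<and> a 0 < a k \<and>
     (\<exists>as. set as \<subseteq> {a. pc.good a} \<and> (\<forall>n. a (Suc n) = (\<Sum>x\<leftarrow>as. x n)))"
    if a: "pc.good a" for a
  proof (intro conjI)
    show "a 0 = 1" "\<forall>n. rec_op p (\<lambda>n. a (n + k) - a n) n = 0"
      using a by (auto simp: pc.good_def pc.incr_def[abs_def])
    have "cone dl (\<lambda>n. real_of_int (pc.incr a n))" using a by (simp add: pc.good_def)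
    from pc.incr_bounds(4)[OF this, of 0] show "a 0 < a k" by (simp add: pc.incr_def)
    let ?as = "map (pc.child a) [0..<nat (a 1)]"
    have "set ?as \<subseteq> {a. pc.good a}" using pc.good_child[OF a] by auto
    moreover have "a (Suc n) = (\<Sum>x\<leftarrow>?as. x n)" for n
    proof -
      have "(\<Sum>x\<leftarrow>?as. x n) = (\<Sum>j<nat (a 1). pc.child a j n)"
        by (simp add: comp_def interv_sum_list_conv_sum_set_nat atLeast0LessThan)
      then show ?thesis using pc.sum_child[OF a, of n] by simp
    qed
    ultimately show "\<exists>as. set as \<subseteq> {a. pc.good a} \<and> (\<forall>n. a (Suc n) = (\<Sum>x\<leftarrow>as. x n))" by blast
  qed
  then show ?thesis using k(1) pc.finite_good ne by (intro exI[of _ k] exI[of _ "{a. pc.good a}"]) auto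
qed

end

section \<open>The Perron root of an irreducible polynomial\<close>

lemma map_poly_of_real_mult:
  "map_poly complex_of_real (f * g) = map_poly complex_of_real f * map_poly complex_of_real g"
  by (rule poly_eqI) (simp add: coeff_mult coeff_map_poly)

text \<open>Irreducibility makes \<open>lam\<close> a simple root, so it is no root of the cofactor.
  The finitely many remaining moduli leave room for \<open>r\<close>.\<close>

lemma perron_factor:
  fixes p :: "int poly" and lam :: real
  assumes irr: "irreducible p" and monic: "lead_coeff p = 1" and lam: "0 < lam"
    and root: "poly (map_poly complex_of_int p) (complex_of_real lam) = 0"
    and dom: "\<And>z. poly (map_poly complex_of_int p) z = 0 \<Longrightarrow> z \<noteq> complex_of_real lam \<Longrightarrow> cmod z < lam"
  obtains q r zs where "map_poly real_of_int p = [:- lam, 1:] * q"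
    "map_poly complex_of_real q = (\<Prod>z\<leftarrow>zs. [:- z, 1:])"
    "\<And>z. z \<in> set zs \<Longrightarrow> cmod z < r" "0 < r" "r < lam"
proof -
  let ?P = "map_poly complex_of_int p" and ?R = "map_poly real_of_int p"
  have PR: "?P = map_poly complex_of_real ?R" by (simp add: map_poly_map_poly comp_def)
  have "complex_of_real (poly ?R lam) = 0"
    using root unfolding PR of_real_hom.poly_map_poly .
  then have R0: "poly ?R lam = 0" by simp
  define q where "q = synthetic_div ?R lam"
  have q: "?R = [:- lam, 1:] * q"
    using synthetic_div_correct'[of lam ?R] R0 by (simp add: q_def)
  define Q where "Q = map_poly complex_of_real q"
  have P: "?P = [:- complex_of_real lam, 1:] * Q"
    unfolding PR q Q_def map_poly_of_real_mult by (simp add: of_real_hom.map_poly_pCons_hom)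
  have "lead_coeff ?P = 1" using monic by simp
  then have "lead_coeff Q = 1" unfolding P lead_coeff_mult by simp
  then obtain zs where zs: "Q = (\<Prod>z\<leftarrow>zs. [:- z, 1:])"
    using fundamental_theorem_algebra_factorized[of Q] by auto
  have "poly (pderiv ?P) (complex_of_real lam) = poly Q (complex_of_real lam)"
    unfolding P pderiv_mult by (simp add: pderiv_pCons)
  then have Qlam: "poly Q (complex_of_real lam) \<noteq> 0"
    using irreducible_root_simple[OF irr root] by simp
  have small: "cmod z < lam" if "z \<in> set zs" for z
  proof -
    have "poly Q z = 0" unfolding zs using that by (auto simp: poly_prod_list prod_list_zero_iff)
    then show ?thesis using dom[of z] Qlam by (auto simp: P)
  qed
  obtain r where "0 < r" "r < lam" "\<forall>x\<in>cmod ` set zs. x < r"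
    using finite_bound_between[of "cmod ` set zs" lam] lam small by auto
  then show ?thesis using that[of q zs r] q zs unfolding Q_def by auto
qed

lemma prod_list_cmod_le_1:
  "(\<And>z. z \<in> set zs \<Longrightarrow> cmod z \<le> 1) \<Longrightarrow> (\<Prod>z\<leftarrow>zs. cmod z) \<le> 1"
  by (induction zs) (auto intro!: mult_le_one prod_list_nonneg)

text \<open>Otherwise all roots have modulus below 1, and so has their product, the constant
  coefficient up to sign. That is a nonzero integer, since a root 0 would transfer to
  \<open>lam\<close>.\<close>

lemma perron_root_ge_1:
  fixes p :: "int poly" and lam :: real
  assumes irr: "irreducible p" and lam: "0 < lam"
    and root: "poly (map_poly complex_of_int p) (complex_of_real lam) = 0"
    and fac: "map_poly real_of_int p = [:- lam, 1:] * q"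
    and q: "map_poly complex_of_real q = (\<Prod>z\<leftarrow>zs. [:- z, 1:])"
    and zs: "\<And>z. z \<in> set zs \<Longrightarrow> cmod z < lam"
  shows "1 \<le> lam"
proof (rule ccontr)
  assume "\<not> 1 \<le> lam"
  then have lam1: "lam < 1" by simp
  have "poly p 0 \<noteq> 0"
  proof
    assume "poly p 0 = 0"
    then have "poly (map_poly complex_of_int p) 0 = 0" by (simp add: of_int_hom.poly_map_poly_0)
    then have "poly (map_poly complex_of_int [:0, 1:]) (complex_of_real lam) = 0"
      by (rule irreducible_root_transfer[OF irr _ _ root]) (simp add: of_int_hom.map_poly_pCons_hom)
    then show False using lam by (simp add: of_int_hom.map_poly_pCons_hom)
  qed
  then have "1 \<le> \<bar>real_of_int (poly p 0)\<bar>" by linarith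
  also have "real_of_int (poly p 0) = - lam * poly q 0"
    using arg_cong[OF fac, of "\<lambda>r. poly r 0"] by (simp add: of_int_hom.poly_map_poly_0)
  also have "\<bar>- lam * poly q 0\<bar> = lam * \<bar>poly q 0\<bar>" using lam by (simp add: abs_mult)
  also have "\<bar>poly q 0\<bar> = cmod (poly (map_poly complex_of_real q) 0)"
    by (simp add: of_real_hom.poly_map_poly_0)
  also have "\<dots> = (\<Prod>z\<leftarrow>zs. cmod z)"
    unfolding q by (induction zs) (simp_all add: norm_mult)
  also have "lam * \<dots> \<le> lam * 1"
    using zs lam lam1 by (intro mult_left_mono prod_list_cmod_le_1) force+
  finally show False using lam1 by simp
qed

lemma perron_root_eq_1:
  fixes p :: "int poly"
  assumes irr: "irreducible p" and monic: "lead_coeff p = 1"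
    and root: "poly (map_poly complex_of_int p) 1 = 0"
  shows "p = [:- 1, 1:]"
proof -
  have "poly (map_poly complex_of_int [:- 1, 1:]) 1 = 0" by (simp add: of_int_hom.map_poly_pCons_hom)
  then have dvd: "p dvd [:- 1, 1:]" by (rule irreducible_dvd_if_common_root[OF irr root])
  then obtain h where h: "[:- 1, 1:] = p * h" by blast
  have "h \<noteq> 0" "p \<noteq> 0" using h irr by (auto simp: irreducible_def)
  then have "degree p + degree h = 1" using arg_cong[OF h, of degree] by (simp add: degree_mult_eq)
  moreover have "degree p \<noteq> 0"
  proof
    assume "degree p = 0"
    then have "p = [:1:]" using monic by (metis degree_0_id)
    then show False using irr by (simp add: irreducible_def)
  qed
  ultimately have "degree h = 0" by simp
  moreover have "lead_coeff h = 1" using arg_cong[OF h, of lead_coeff] monic by (simp add: lead_coeff_mult)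
  ultimately have "h = [:1:]" by (metis degree_0_id)
  then show ?thesis using h by simp
qed

text \<open>\<open>grow\<close> excludes \<open>k\<close>-periodic sequences and so forces the roots
  of \<open>p\<close> into the support. Primality of \<open>k\<close> leaves only two conjugacy
  classes among the \<open>k\<close>-th roots of unity.\<close>

lemma expansion_of_member:
  fixes p :: "int poly" and s :: "nat \<Rightarrow> int" and lam :: real
  assumes irr: "irreducible p" and monic: "lead_coeff p = 1" and k: "prime k"
    and lam: "1 < lam" and root: "poly (map_poly complex_of_int p) (complex_of_real lam) = 0"
    and rec: "\<And>n. rec_op p (\<lambda>n. s (n + k) - s n) n = 0" and grow: "s 0 < s k"
  obtains \<alpha> Z ns where "exp_sum_seq (\<lambda>n. real_of_int (s n)) \<alpha> Z" "0 \<notin> Z" "\<forall>d\<in>set ns. d \<ge> 1"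
    "(\<Prod>z\<in>Z. [:- z, 1:]) = map_poly of_int p * prod_list (map cyclotomic ns)"
proof -
  let ?P = "map_poly complex_of_int p"
  define R where "R = {z. poly ?P z = 0}"
  define U where "U = {z::complex. z ^ k = 1}"
  define F :: "int poly" where "F = p * (monom 1 k - 1)"
  let ?F = "map_poly complex_of_int F"
  have k0: "k > 0" and k1: "k > 1" using prime_gt_0_nat[OF k] prime_gt_1_nat[OF k] .
  have P0: "?P \<noteq> 0" using monic by auto
  have fin: "finite R" "finite U"
    using poly_roots_finite[OF P0] finite_roots_unity[of k] k1 by (auto simp: R_def U_def)
  have lamR: "complex_of_real lam \<in> R" using root by (simp add: R_def)
  \<comment> \<open>A common root would transfer to \<open>lam\<close>, which is neither 0 nor a
    root of unity because \<open>lam > 1\<close>.\<close>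
  have no_common: "poly (map_poly complex_of_int g) z \<noteq> 0"
    if g: "g \<in> {[:0, 1:], monom 1 k - 1}" and z: "z \<in> R" for g z
  proof
    assume "poly (map_poly complex_of_int g) z = 0"
    then have "poly (map_poly complex_of_int g) (complex_of_real lam) = 0"
      using irreducible_root_transfer[OF irr _ _ root] z by (simp add: R_def)
    moreover have "poly (map_poly complex_of_int (monom 1 k - 1)) (complex_of_real lam)
        = complex_of_real (lam ^ k - 1)"
      by (simp add: of_int_poly_hom.hom_minus poly_monom)
    moreover have "lam ^ k > 1" using lam k0 by simp
    ultimately show False using g lam by (auto simp: of_int_hom.map_poly_pCons_hom simp del: of_real_diff of_real_power)
  qed
  have UP: "poly (map_poly complex_of_int (monom 1 k - 1)) z = z ^ k - 1" for z
    by (simp add: of_int_poly_hom.hom_minus poly_monom)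
  have disj: "R \<inter> U = {}" using no_common[of "monom 1 k - 1"] UP by (auto simp: U_def)
  have R0: "0 \<notin> R" using no_common[of "[:0, 1:]" 0] by (auto simp: of_int_hom.map_poly_pCons_hom)
  have U0: "0 \<notin> U" using k0 by (simp add: U_def power_0_left)
  have P_split: "?P = (\<Prod>z\<in>R. [:- z, 1:])"
    unfolding R_def using monic irreducible_root_simple[OF irr] by (intro split_into_roots) auto
  have U_split: "map_poly complex_of_int (monom 1 k - 1) = (\<Prod>z\<in>U. [:- z, 1:])"
  proof -
    let ?u = "map_poly complex_of_int (monom 1 k - 1)"
    have u: "?u = monom 1 k - 1" by (simp add: of_int_poly_hom.hom_minus)
    have "degree (monom 1 k + (- 1) :: complex poly) = k"
      using degree_add_eq_left[of "- 1 :: complex poly" "monom 1 k"] k0 by (simp add: degree_monom_eq)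
    then have deg: "degree (monom 1 k - 1 :: complex poly) = k" by simp
    have "{z. poly ?u z = 0} = U" by (simp add: UP U_def)
    moreover have "?u = (\<Prod>z\<in>{z. poly ?u z = 0}. [:- z, 1:])"
    proof (rule split_into_roots)
      show "lead_coeff ?u = 1" unfolding u deg using k0 by simp
      fix z assume "poly ?u z = 0"
      then have "z ^ k = 1" by (simp add: UP)
      then have "z \<noteq> 0" using k0 by (auto simp: power_0_left)
      then show "poly (pderiv ?u) z \<noteq> 0"
        using k0 unfolding u by (simp add: pderiv_diff pderiv_monom poly_monom)
    qed
    ultimately show ?thesis by simp
  qed
  have F_split: "?F = (\<Prod>z\<in>R \<union> U. [:- z, 1:])"
    unfolding F_def of_int_poly_hom.hom_mult U_split
    using prod.union_disjoint[OF fin disj, of "\<lambda>z. [:- z, 1:]"] P_split by simp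
  have "rec_op (monom 1 k - 1) s n = s (n + k) - s n" for n
  proof -
    have "rec_op (monom 1 k :: int poly) s n = s (n + k)" for n
      by (simp add: rec_op_def degree_monom_eq coeff_monom if_distrib[of "\<lambda>x. x * _"] cong: if_cong)
    then show ?thesis using rec_op_add[of "monom 1 k - 1" 1 s n] by simp
  qed
  then have "rec_op (monom 1 k - 1) s = (\<lambda>n. s (n + k) - s n)" by (rule ext)
  then have recF: "rec_op F s n = 0" for n
    by (simp only: F_def rec_op_mult rec)
  let ?s = "\<lambda>n. complex_of_int (s n)"
  have "rec_op (\<Prod>z\<in>R \<union> U. [:- z, 1:]) ?s n = 0" for n
    by (simp only: F_split[symmetric] rec_op_of_int recF of_int_0)
  then obtain \<alpha> where \<alpha>: "\<And>n. ?s n = (\<Sum>z\<in>R \<union> U. \<alpha> z * z ^ n)"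
    using exp_sum_exists[of "R \<union> U" ?s] fin by blast
  obtain G where G: "\<And>z. rec_op (synthetic_div ?F z) ?s 0 = poly (map_poly of_int G) z"
    using exp_sum_coeff_int_poly by blast
  \<comment> \<open>The cofactor of a linear factor of \<open>F\<close> is the product over the
    other bases, so \<open>G\<close> at \<open>z\<close> is the coefficient times a nonzero product
    of differences.\<close>
  have \<alpha>G: "\<alpha> z = 0 \<longleftrightarrow> poly (map_poly of_int G) z = 0" if z: "z \<in> R \<union> U" for z
  proof -
    let ?T = "\<Prod>w\<in>R \<union> U - {z}. [:- w, 1:]"
    have finU: "finite (R \<union> U)" using fin by simp
    have F1: "?F = [:- z, 1:] * ?T" unfolding F_split by (rule prod.remove[OF finU z])
    then have "poly ?F z = 0" by simp
    then have "?F = [:- z, 1:] * synthetic_div ?F z" using synthetic_div_correct'[of z ?F] by simp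
    then have "[:- z, 1:] * synthetic_div ?F z = [:- z, 1:] * ?T" using F1 by (simp only:)
    then have sd: "synthetic_div ?F z = ?T" by (subst (asm) mult_cancel_left) simp
    have "poly (map_poly of_int G) z = rec_op ?T ?s 0" by (simp only: G[symmetric] sd)
    also have "\<dots> = \<alpha> z * (\<Prod>w\<in>R \<union> U - {z}. z - w)"
      using rec_op_isolate[OF finU z, of \<alpha> 0] by (simp only: \<alpha>) simp
    finally show ?thesis using finU by auto
  qed
  define Z where "Z = {z\<in>R \<union> U. \<alpha> z \<noteq> 0}"
  have Z: "?s n = (\<Sum>z\<in>Z. \<alpha> z * z ^ n)" for n
    unfolding \<alpha> Z_def by (rule sum.mono_neutral_right) (use fin in auto)
  have RZ: "R \<subseteq> Z"
  proof (rule ccontr)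
    \<comment> \<open>One vanishing coefficient on \<open>R\<close> makes all of them vanish; only
      roots of unity remain, and \<open>s k = s 0\<close> follows.\<close>
    assume "\<not> R \<subseteq> Z"
    then obtain z where z: "z \<in> R" "\<alpha> z = 0" by (auto simp: Z_def)
    have "\<alpha> w = 0" if "w \<in> R" for w
      using irreducible_root_transfer[OF irr, of z G w] \<alpha>G z that by (auto simp: R_def)
    then have ZU: "Z \<subseteq> U" by (auto simp: Z_def)
    have "?s k = ?s 0"
      unfolding Z by (rule sum.cong) (use ZU in \<open>auto simp: U_def\<close>)
    then show False using grow by simp
  qed
  define U' where "U' = U - {1}"
  have U'roots: "poly (map_poly of_int (prime_cyclo k)) z = 0 \<longleftrightarrow> z \<in> U'" for z :: complex
    using prime_cyclo_root_iff[OF k0] by (auto simp: U'_def U_def)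
  have U': "U' \<subseteq> Z" if z: "z \<in> U'" "z \<in> Z" for z
  proof
    fix w assume w: "w \<in> U'"
    show "w \<in> Z"
    proof (rule ccontr)
      assume "w \<notin> Z"
      then have "\<alpha> w = 0" using w by (auto simp: Z_def U'_def)
      then have "\<alpha> z = 0"
        using irreducible_root_transfer[OF prime_cyclo_irreducible[OF k], of w G z] \<alpha>G U'roots z(1) w
        by (auto simp: U'_def)
      then show False using z(2) by (simp add: Z_def)
    qed
  qed
  \<comment> \<open>Only the cyclotomic polynomials of orders 1 and \<open>k\<close> can occur, each
    at most once.\<close>
  define ns where "ns = (if 1 \<in> Z then [1] else []) @ (if U' \<subseteq> Z then [k] else [])"
  have finU': "finite U'" using fin by (simp add: U'_def)
  have disj': "R \<inter> U' = {}" "1 \<notin> R \<union> U'" using disj by (auto simp: U'_def U_def)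
  have Z_eq: "Z = R \<union> ((if 1 \<in> Z then {1} else {}) \<union> (if U' \<subseteq> Z then U' else {}))"
  proof
    show "Z \<subseteq> R \<union> ((if 1 \<in> Z then {1} else {}) \<union> (if U' \<subseteq> Z then U' else {}))"
    proof
      fix z assume z: "z \<in> Z"
      then have "z \<in> R \<or> z = 1 \<or> z \<in> U'" by (auto simp: Z_def U'_def)
      then show "z \<in> R \<union> ((if 1 \<in> Z then {1} else {}) \<union> (if U' \<subseteq> Z then U' else {}))"
        using z U'[of z] by auto
    qed
  qed (use RZ in auto)
  have cyc: "prod_list (map cyclotomic ns)
      = (\<Prod>z\<in>(if 1 \<in> Z then {1} else {}) \<union> (if U' \<subseteq> Z then U' else {}). [:- z, 1:])"
  proof -
    have ck: "cyclotomic k = (\<Prod>z\<in>U'. [:- z, 1:])"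
      by (simp only: cyclotomic_prime[OF k] U'_def U_def)
    have one: "(\<Prod>z\<in>{1 :: complex}. [:- z, 1:]) = [:- 1, 1:]" by simp
    have union: "(\<Prod>z\<in>{1} \<union> U'. [:- z, 1:]) = [:- 1, 1:] * (\<Prod>z\<in>U'. [:- z, 1:])"
      using finU' disj' by (subst prod.union_disjoint) auto
    show ?thesis
      by (cases "1 \<in> Z"; cases "U' \<subseteq> Z"; simp only: ns_def if_True if_False append.simps
          list.map prod_list.Cons prod_list.Nil mult_1_right Un_empty_left Un_empty_right
          prod.empty cyclotomic_1 ck one union)
  qed
  have "(\<Prod>z\<in>Z. [:- z, 1:]) = ?P * prod_list (map cyclotomic ns)"
    unfolding cyc P_split
    by (subst Z_eq, rule prod.union_disjoint) (use fin finU' disj' in \<open>auto split: if_splits\<close>)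
  moreover have "exp_sum_seq (\<lambda>n. real_of_int (s n)) \<alpha> Z"
    by unfold_locales (use fin Z in \<open>auto simp: Z_def\<close>)
  moreover have "0 \<notin> Z" using R0 U0 by (auto simp: Z_def)
  moreover have "\<forall>d\<in>set ns. d \<ge> 1" using k0 by (auto simp: ns_def)
  ultimately show ?thesis using that by blast
qed

theorem theorem5p3:
  fixes p :: "int poly"
  assumes "irreducible p" and "perron_poly p"
  shows "\<exists>(m::nat) (f :: nat \<Rightarrow> letter list).
           m \<ge> 1 \<and> (\<forall>i<m. word_on m (f i) \<and> reduce (f i) = f i) \<and>
           (\<forall>i<m.
              let a = (\<lambda>n. real (word_length ((endo_apply f ^^ n) [(i, False)]))) in
              linearly_recurrent (\<lambda>n. a (Suc n)) \<and>
              (\<exists>ns. (\<forall>d\<in>set ns. d \<ge> 1) \<and>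
                 minimal_poly_seq (\<lambda>n. a (Suc n))
                   (map_poly complex_of_int p * prod_list (map cyclotomic ns))) \<and>
              (\<forall>k. GR k a \<le> ereal (mahler_measure p)) \<and>
              (\<exists>k. GR k a = ereal (mahler_measure p)))"
proof -
  have monic: "lead_coeff p = 1" using assms(2) by (simp add: perron_poly_def)
  obtain lam where lam: "0 < lam" and root: "poly (map_poly complex_of_int p) (complex_of_real lam) = 0"
    and dom: "\<And>z. poly (map_poly complex_of_int p) z = 0 \<Longrightarrow> z \<noteq> complex_of_real lam \<Longrightarrow> cmod z < lam"
    using assms(2) by (auto simp: perron_poly_def)
  obtain q r zs where fac: "map_poly real_of_int p = [:- lam, 1:] * q"
    "map_poly complex_of_real q = (\<Prod>z\<leftarrow>zs. [:- z, 1:])"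
    and zs: "\<And>z. z \<in> set zs \<Longrightarrow> cmod z < r" "0 < r" "r < lam"
    using perron_factor[OF assms(1) monic lam root dom] by metis
  have "1 \<le> lam"
    by (rule perron_root_ge_1[OF assms(1) lam root fac]) (use zs in force)
  have "\<exists>S. finite S \<and> S \<noteq> {} \<and> (\<forall>s\<in>S. s 0 = 1 \<and>
      (\<exists>as. set as \<subseteq> S \<and> (\<forall>n. s (Suc n) = (\<Sum>x\<leftarrow>as. x n :: int))) \<and>
      (\<exists>\<alpha> Z ns. exp_sum_seq (\<lambda>n. real_of_int (s n)) \<alpha> Z \<and> 0 \<notin> Z \<and> (\<forall>d\<in>set ns. d \<ge> 1) \<and>
        (\<Prod>z\<in>Z. [:- z, 1:]) = map_poly of_int p * prod_list (map cyclotomic ns)))"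
  proof (cases "lam = 1")
    \<comment> \<open>The cone construction needs \<open>lam > 1\<close>. Here the identity on one
      generator, with constant length 1, does the job.\<close>
    case True
    then have p: "p = [:- 1, 1:]" using perron_root_eq_1[OF assms(1) monic] root by simp
    let ?one = "\<lambda>_ :: nat. 1 :: int"
    have "exp_sum_seq (\<lambda>n. real_of_int (?one n)) (\<lambda>_. 1) {1}" by unfold_locales auto
    moreover have "(\<Prod>z\<in>{1}. [:- z, 1:]) = map_poly of_int p * prod_list (map cyclotomic [])"
      by (simp add: p of_int_hom.map_poly_pCons_hom)
    ultimately have "\<exists>\<alpha> Z ns. exp_sum_seq (\<lambda>n. real_of_int (?one n)) \<alpha> Z \<and> 0 \<notin> Z \<and>
        (\<forall>d\<in>set ns. d \<ge> 1) \<and> (\<Prod>z\<in>Z. [:- z, 1:]) = map_poly of_int p * prod_list (map cyclotomic ns)"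
      by (intro exI[of _ "\<lambda>_. 1"] exI[of _ "{1}"] exI[of _ "[]"] conjI) simp_all
    moreover have "\<exists>as. set as \<subseteq> {?one} \<and> (\<forall>n. ?one (Suc n) = (\<Sum>x\<leftarrow>as. x n))"
      by (intro exI[of _ "[?one]"]) simp
    ultimately show ?thesis by (intro exI[of _ "{?one}"]) simp
  next
    case False
    then have lam1: "1 < lam" using \<open>1 \<le> lam\<close> by simp
    interpret perron_factorization p q lam r zs
      by unfold_locales (use monic fac zs lam1 in auto)
    obtain k S where kS: "prime k" "finite S" "S \<noteq> {}" and S: "\<And>a. a \<in> S \<Longrightarrow> a 0 = 1 \<and>
       (\<forall>n. rec_op p (\<lambda>n. a (n + k) - a n) n = 0) \<and> a 0 < a k \<and>
       (\<exists>as. set as \<subseteq> S \<and> (\<forall>n. a (Suc n) = (\<Sum>x\<leftarrow>as. x n :: int)))"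
      using family_exists by blast
    have "\<exists>\<alpha> Z ns. exp_sum_seq (\<lambda>n. real_of_int (s n)) \<alpha> Z \<and> 0 \<notin> Z \<and> (\<forall>d\<in>set ns. d \<ge> 1) \<and>
        (\<Prod>z\<in>Z. [:- z, 1:]) = map_poly of_int p * prod_list (map cyclotomic ns)" if s: "s \<in> S" for s
      by (rule expansion_of_member[OF assms(1) monic kS(1) lam1 root, of s]) (use S[OF s] in auto)
    then show ?thesis using kS S by (intro exI[of _ S]) auto
  qed
  then obtain S where S: "finite S" "S \<noteq> {}" and start: "\<forall>s\<in>S. s 0 = 1"
    and split: "\<forall>s\<in>S. \<exists>as. set as \<subseteq> S \<and> (\<forall>n. s (Suc n) = (\<Sum>x\<leftarrow>as. x n :: int))"
    and expansion: "\<And>s. s \<in> S \<Longrightarrow> \<exists>\<alpha> Z ns. exp_sum_seq (\<lambda>n. real_of_int (s n)) \<alpha> Z \<and> 0 \<notin> Z \<and>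
        (\<forall>d\<in>set ns. d \<ge> 1) \<and> (\<Prod>z\<in>Z. [:- z, 1:]) = map_poly of_int p * prod_list (map cyclotomic ns)"
    by blast
  obtain m f where m: "m \<ge> 1" and f: "\<And>i. i < m \<Longrightarrow> word_on m (f i) \<and> reduce (f i) = f i"
    and lengths: "\<And>i. i < m \<Longrightarrow>
      \<exists>s\<in>S. \<forall>n. int (word_length ((endo_apply f ^^ n) [(i, False)])) = s n"
    using endo_of_family[OF S start split] by metis
  show ?thesis
  proof (intro exI[of _ m] exI[of _ f] conjI allI impI)
    show "m \<ge> 1" by (rule m)
    fix i assume i: "i < m"
    show "word_on m (f i)" "reduce (f i) = f i" using f[OF i] by auto
    obtain s where s: "s \<in> S" "\<And>n. int (word_length ((endo_apply f ^^ n) [(i, False)])) = s n"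
      using lengths[OF i] by blast
    have a: "(\<lambda>n. real (word_length ((endo_apply f ^^ n) [(i, False)]))) = (\<lambda>n. real_of_int (s n))"
      by (simp flip: s(2))
    obtain \<alpha> Z ns where Z: "exp_sum_seq (\<lambda>n. real_of_int (s n)) \<alpha> Z" "0 \<notin> Z" "\<forall>d\<in>set ns. d \<ge> 1"
      "(\<Prod>z\<in>Z. [:- z, 1:]) = map_poly of_int p * prod_list (map cyclotomic ns)"
      using expansion[OF s(1)] by blast
    show "let a = (\<lambda>n. real (word_length ((endo_apply f ^^ n) [(i, False)]))) in
              linearly_recurrent (\<lambda>n. a (Suc n)) \<and>
              (\<exists>ns. (\<forall>d\<in>set ns. d \<ge> 1) \<and>
                 minimal_poly_seq (\<lambda>n. a (Suc n))
                   (map_poly complex_of_int p * prod_list (map cyclotomic ns))) \<and>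
              (\<forall>k. GR k a \<le> ereal (mahler_measure p)) \<and>
              (\<exists>k. GR k a = ereal (mahler_measure p))"
      unfolding Let_def a by (rule exp_sum_seq.growth_conclusion[OF Z])
  qed
qed

end
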